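(* Let $A$ be an even integer and $r$ a positive integer with $A-2r>0$, and let $\alpha=-A/8-r^2/2$. Then there exist real numbers $\beta,\gamma$ depending only on $A$ and $r$ such that for every integer $n\geq0$, $$q^{\lfloor\alpha n^2+\beta n+\gamma\rfloor}\,d_n(1/q)^{A-1}\,\hat{P}_{0,n}(q)\in\mathbb{Z}\left[\frac{1}{q}\right].$$
   Context: Here $q$ is an indeterminate and all objects are rational functions of $q$ with rational coefficients. For $k\in\mathbb{N}$, $(a)_k=(a;q)_k=\prod_{i=0}^{k-1}(1-aq^i)$ (equal to $1$ for $k=0$), and $(a_1,\dots,a_m)_k=(a_1)_k\cdots(a_m)_k$. $d_n(q)\in\mathbb{Z}[q]$ is the monic polynomial of smallest degree which is a common multiple of $1-q,1-q^2,\dots,1-q^n$ (with $d_0=1$), and $d_n(1/q)$ is obtained by substituting $1/q$ for $q$. $\lfloor x\rfloor$ is the integer part. Define the rational function of $T$ $$\tilde{R}_n(T;q)=T^{(A-2r)n/2+A/2-2}q^{-An(n+1)/2}\frac{(q)_n^{A-2r}\,(q^{-rn}T,q^{n+1}T)_{rn}}{(T-1)^A(T-q^{-1})^A\cdots(T-q^{-n})^A},$$ whose degree in $T$ is at most $-3$, and define $\tilde{c}_{s,j,n}(q)$ ($1\le s\le A$, $0\le j\le n$) by the partial fraction decomposition $\tilde{R}_n(T;q)=\sum_{s=1}^A\sum_{j=0}^n\frac{\tilde{c}_{s,j,n}(q)}{(T-q^{-j})^s}$. Define $$\tilde{P}_{0,n}(z,q)=\sum_{s=1}^A\sum_{j=1}^n\sum_{k=1}^j(-1)^s\frac{q^{k-j(1-s)}}{(1-q^k)^s}\tilde{c}_{s,j,n}(q)z^{j-k},\qquad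 \tilde{P}_{1,n}(z,q)=-\sum_{j=0}^n\tilde{c}_{1,j,n}(q)z^j,$$ and $$\hat{P}_{0,n}(q)=\tilde{P}_{0,n}(1,q)-q^{-n(r-1)}\tilde{P}_{0,n}(1,1/q)-\left[\frac{d}{dz}\tilde{P}_{1,n}(z,q)\right]_{z=1},$$ where $\tilde{P}_{0,n}(1,1/q)$ denotes the substitution of $1/q$ for $q$ (including inside $\tilde c_{s,j,n}$). *)

theory Defs
  imports Complex_Main
    "HOL-Computational_Algebra.Computational_Algebra"
    "HOL-Computational_Algebra.Field_as_Ring"
begin

type_synonym ratfun = "rat poly fract"

definition qq :: ratfun where
  "qq = to_fract [:0, 1:]"

definition int_poly_at :: "int poly \<Rightarrow> ratfun \<Rightarrow> ratfun" where
  "int_poly_at p x = poly (map_poly of_int p) x"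

definition rat_poly_at :: "rat poly \<Rightarrow> ratfun \<Rightarrow> ratfun" where
  "rat_poly_at p x = poly (map_poly of_rat p) x"

text \<open>The substitution of \<open>1/q\<close> for \<open>q\<close> in a rational function. It is computed on the
  normalised quotient representation, but does not depend on the representation: see
  \<open>subst_inv_q_divide\<close> below.\<close>

definition subst_inv_q :: "ratfun \<Rightarrow> ratfun" where
  "subst_inv_q f =
     rat_poly_at (fst (quot_of_fract f)) (1 / qq) / rat_poly_at (snd (quot_of_fract f)) (1 / qq)"

definition Z_inv_q :: "ratfun set" where
  "Z_inv_q = range (\<lambda>p :: int poly. int_poly_at p (1 / qq))"

definition qpoch :: "'a :: comm_ring_1 \<Rightarrow> 'a \<Rightarrow> nat \<Rightarrow> 'a" where
  "qpoch a x k = (\<Prod>i<k. 1 - a * x ^ i)"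

definition is_common_mult :: "nat \<Rightarrow> int poly \<Rightarrow> bool" where
  "is_common_mult n p \<longleftrightarrow> (\<forall>k\<in>{1..n}. (1 - monom 1 k) dvd p)"

definition d_poly :: "nat \<Rightarrow> int poly" where
  "d_poly n = (THE p. lead_coeff p = 1 \<and> is_common_mult n p \<and>
     (\<forall>p'. lead_coeff p' = 1 \<and> is_common_mult n p' \<longrightarrow> degree p \<le> degree p'))"

text \<open>Rational functions of \<open>T\<close> with coefficients in the field of rational functions of \<open>q\<close>.\<close>

type_synonym ratfun_T = "ratfun poly fract"

definition TT :: ratfun_T where
  "TT = to_fract [:0, 1:]"

definition const_T :: "ratfun \<Rightarrow> ratfun_T" where
  "const_T x = to_fract [:x:]"

definition R_tilde :: "nat \<Rightarrow> nat \<Rightarrow> nat \<Rightarrow> ratfun_T" where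
  "R_tilde A r n =
     TT powi ((int A - 2 * int r) * int n div 2 + int A div 2 - 2)
     * const_T (qq powi (- (int A * int n * (int n + 1) div 2)))
     * (const_T (qpoch qq qq n ^ (A - 2 * r))
        * (qpoch (const_T (qq powi (- (int r * int n))) * TT) (const_T qq) (r * n)
           * qpoch (const_T (qq ^ (n + 1)) * TT) (const_T qq) (r * n))
        / (\<Prod>j=0..n. (TT - const_T (qq powi (- int j))) ^ A))"

text \<open>The coefficients of the partial fraction decomposition; the first conjunct only fixes the
  values at irrelevant indices, so that the description is definite.\<close>

definition c_tilde :: "nat \<Rightarrow> nat \<Rightarrow> nat \<Rightarrow> nat \<Rightarrow> nat \<Rightarrow> ratfun" where
  "c_tilde A r n = (THE c.
     (\<forall>s j. s \<notin> {1..A} \<or> j \<notin> {0..n} \<longrightarrow> c s j = 0) \<and>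
     R_tilde A r n =
       (\<Sum>s=1..A. \<Sum>j=0..n. const_T (c s j) / (TT - const_T (qq powi (- int j))) ^ s))"

text \<open>\<open>P0_tilde\<close> and \<open>P1_tilde\<close> are polynomials in \<open>z\<close>.\<close>

definition P0_tilde :: "nat \<Rightarrow> nat \<Rightarrow> nat \<Rightarrow> ratfun poly" where
  "P0_tilde A r n =
     (\<Sum>s=1..A. \<Sum>j=1..n. \<Sum>k=1..j.
        monom ((-1) ^ s * (qq powi (int k - int j * (1 - int s)) / (1 - qq ^ k) ^ s)
               * c_tilde A r n s j) (j - k))"

definition P1_tilde :: "nat \<Rightarrow> nat \<Rightarrow> nat \<Rightarrow> ratfun poly" where
  "P1_tilde A r n = - (\<Sum>j=0..n. monom (c_tilde A r n 1 j) j)"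

definition P0_hat :: "nat \<Rightarrow> nat \<Rightarrow> nat \<Rightarrow> ratfun" where
  "P0_hat A r n =
     poly (P0_tilde A r n) 1
     - qq powi (- (int n * (int r - 1))) * subst_inv_q (poly (P0_tilde A r n) 1)
     - poly (pderiv (P1_tilde A r n)) 1"

lemma d_poly_ex1:
  "\<exists>!p. lead_coeff p = 1 \<and> is_common_mult n p \<and>
     (\<forall>p'. lead_coeff p' = 1 \<and> is_common_mult n p' \<longrightarrow> degree p \<le> degree p')"
proof -
  define S where "S = (\<lambda>k. 1 - monom 1 k :: int poly) ` {1..n}"
  have cm: "is_common_mult n p \<longleftrightarrow> Lcm S dvd p" for p
    by (auto simp: is_common_mult_def S_def Lcm_dvd_iff)
  have "Lcm S dvd \<Prod>S" by (auto intro!: Lcm_least dvd_prodI simp: S_def)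
  moreover have "lead_coeff x dvd 1" if x: "x \<in> S" for x
  proof -
    obtain k where k: "k \<ge> 1" "x = 1 - monom 1 k"
      using x unfolding S_def by fastforce
    have "degree x = k"
      using k degree_add_eq_right[of 1 "- monom 1 k :: int poly"] by (simp add: degree_monom_eq)
    then show ?thesis using k by simp
  qed
  then have "(\<Prod>x\<in>S. lead_coeff x) dvd (\<Prod>x\<in>S. 1)"
    by (rule prod_dvd_prod)
  then have "lead_coeff (\<Prod>S) dvd 1"
    by (simp add: lead_coeff_prod)
  moreover have "lead_coeff p dvd lead_coeff p'" if "p dvd p'" for p p' :: "int poly"
    using that by (auto simp: lead_coeff_mult elim!: dvdE)
  ultimately have "lead_coeff (Lcm S) dvd 1"
    using dvd_trans by blast
  then obtain u where u: "u * lead_coeff (Lcm S) = 1" "is_unit u"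
    by (elim dvdE) (metis dvd_triv_left mult.commute)
  define L where "L = smult u (Lcm S)"
  have lL: "lead_coeff L = 1" using u by (simp add: L_def)
  have cmL: "is_common_mult n p \<longleftrightarrow> L dvd p" for p
  proof -
    have "u * u = 1" using u(2) by (auto simp: zdvd1_eq abs_if split: if_splits)
    then have "smult u L = Lcm S" by (simp add: L_def)
    then have "L dvd Lcm S" by (metis dvd_refl dvd_smult)
    moreover have "Lcm S dvd L" unfolding L_def by (rule dvd_smult) simp
    ultimately show ?thesis unfolding cm using dvd_trans by blast
  qed
  show ?thesis
  proof (rule ex1I[of _ L])
    show "lead_coeff L = 1 \<and> is_common_mult n L \<and>
      (\<forall>p'. lead_coeff p' = 1 \<and> is_common_mult n p' \<longrightarrow> degree L \<le> degree p')"
      using lL by (auto simp: cmL intro!: dvd_imp_degree_le)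
  next
    fix p assume p: "lead_coeff p = 1 \<and> is_common_mult n p \<and>
      (\<forall>p'. lead_coeff p' = 1 \<and> is_common_mult n p' \<longrightarrow> degree p \<le> degree p')"
    then obtain c where c: "p = L * c" by (auto simp: cmL elim: dvdE)
    have "degree p \<le> degree L" using p lL by (simp add: cmL)
    moreover have "c \<noteq> 0" "L \<noteq> 0" using p c by auto
    ultimately have "degree c = 0" using c by (simp add: degree_mult_eq)
    moreover have "lead_coeff c = 1" using p c lL by (simp add: lead_coeff_mult)
    ultimately have "c = 1" by (auto elim!: degree_eq_zeroE)
    then show "p = L" using c by simp
  qed
qed

lemma rat_poly_at_mult: "rat_poly_at (p * p') x = rat_poly_at p x * rat_poly_at p' x"
proof -
  have "map_poly of_rat (p * p') = map_poly of_rat p * (map_poly of_rat p' :: ratfun poly)"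
    by (rule poly_eqI) (simp add: coeff_map_poly coeff_mult of_rat_sum of_rat_mult)
  then show ?thesis by (simp add: rat_poly_at_def)
qed

lemma to_fract_eq_rat_poly_at: "to_fract p = rat_poly_at p qq"
proof -
  have c: "to_fract [:a:] = of_rat a" for a :: rat
  proof -
    obtain m n where a: "a = of_int m / of_int n" "n > 0"
      by (metis quotient_of_div quotient_of_denom_pos surj_pair)
    have e: "to_fract (of_int k) = (of_int k :: ratfun)" for k
      by (induction k rule: int_induct[of _ 0]) (simp_all)
    have "to_fract [:a:] * of_int n = to_fract ([:a:] * of_int n)"
      by (simp only: e to_fract_mult)
    also have "[:a:] * of_int n = of_int m"
      using a by (simp add: of_int_poly)
    finally have "to_fract [:a:] = (of_int m / of_int n :: ratfun)"
      using a(2) by (simp add: e nonzero_eq_divide_eq)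
    then show ?thesis by (simp add: a(1) of_rat_divide)
  qed
  show ?thesis
  proof (induction p)
    case (pCons a p)
    have "to_fract (pCons a p) = to_fract ([:a:] + [:0, 1:] * p)" by simp
    also have "\<dots> = of_rat a + qq * to_fract p"
      by (simp only: to_fract_add to_fract_mult c qq_def)
    finally show ?case using pCons by (simp add: rat_poly_at_def map_poly_pCons)
  qed (simp add: rat_poly_at_def)
qed

lemma qq_nonzero: "qq \<noteq> 0"
  by (simp add: qq_def)

lemma rat_poly_at_inv_q_nonzero:
  assumes "p \<noteq> 0"
  shows "rat_poly_at p (1 / qq) \<noteq> 0"
proof
  assume a: "rat_poly_at p (1 / qq) = 0"
  let ?m = "map_poly of_rat p :: ratfun poly"
  have "poly (reflect_poly ?m) qq = 0"
    using a poly_reflect_poly_nz[of qq ?m] qq_nonzero by (simp add: rat_poly_at_def field_simps)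
  moreover have "reflect_poly ?m = map_poly of_rat (reflect_poly p)"
    by (rule poly_eqI) (simp add: coeff_reflect_poly coeff_map_poly degree_map_poly)
  ultimately have "to_fract (reflect_poly p) = 0"
    by (simp add: to_fract_eq_rat_poly_at rat_poly_at_def)
  then show False using assms by simp
qed

lemma subst_inv_q_divide:
  assumes "b \<noteq> 0"
  shows "subst_inv_q (rat_poly_at a qq / rat_poly_at b qq)
    = rat_poly_at a (1 / qq) / rat_poly_at b (1 / qq)"
proof -
  let ?f = "rat_poly_at a qq / rat_poly_at b qq"
  obtain c d where cd: "quot_of_fract ?f = (c, d)" by force
  have d: "d \<noteq> 0" using snd_quot_of_fract_nonzero[of ?f] cd by simp
  have "?f = to_fract c / to_fract d"
    using to_fract_quot_of_fract[of ?f] cd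
    by (metis Fract_conv_to_fract Fract_quot_of_fract fst_conv snd_conv)
  then have "to_fract (a * d) = to_fract (c * b)"
    using assms d by (simp add: to_fract_eq_rat_poly_at [symmetric] field_simps)
  then have "a * d = c * b" by (simp only: to_fract_eq_iff)
  then have "rat_poly_at a (1 / qq) * rat_poly_at d (1 / qq)
      = rat_poly_at c (1 / qq) * rat_poly_at b (1 / qq)"
    by (simp add: rat_poly_at_mult [symmetric])
  then show ?thesis
    using rat_poly_at_inv_q_nonzero[OF assms] rat_poly_at_inv_q_nonzero[OF d]
    by (simp add: subst_inv_q_def cd field_simps)
qed

end

theory Submission
  imports Defs
begin

text \<open>
  The rational function \<open>P0_hat\<close> is written as a sum over the poles \<open>q\<^bsup>-j\<^esup>\<close> of the coefficients
  \<open>q\<^bsup>j(s-1)\<^esup> c(s,j)\<close> with explicit weights; the term with \<open>1/q\<close> is absorbed by the symmetry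
  \<open>j \<mapsto> n - j\<close>. Membership in \<open>\<int>[1/q]\<close> is then tested at every prime \<open>p\<close> of this ring. At the prime \<open>1/q\<close>
  it is a bound on the degree in \<open>q\<close>. At a prime \<open>p\<close> dividing \<open>1 - q\<^sup>d\<close>, with \<open>d \<le> n\<close> minimal, expanding
  at \<open>T = q\<^bsup>-j\<^esup> (1 + (1 - q\<^sup>d) X)\<close> shows that the pole has order at most \<open>A\<close>. Modulo \<open>1 - q\<^sup>d\<close> the
  expansion degenerates to that of a classical rational function which is symmetric on each residue
  class modulo \<open>d\<close>, whereas the weights are antisymmetric there; hence the order is at most \<open>A - 1\<close>.
  At all other primes the sum is integral.
\<close>

subsection \<open>Congruences in a subring\<close>

text \<open>The scale \<open>1 - q^d\<close> of the local variable is forced: for \<open>d\<close>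
  dividing \<open>k\<close> it makes both coefficients of \<open>1 - q^k (1 + (1 - q^d) X)\<close>
  divisible by \<open>1 - q^d\<close>, so that powers of it can be split off above and below and
  merely counted. This count treats each pole separately and stops at \<open>A\<close>; the last
  power has to come from cancellation between different poles. The symmetry under
  \<open>j -> n - j\<close> cannot supply it, because it inverts \<open>q\<close> and in general
  changes the residue class of \<open>j\<close>, hence the constants left over modulo
  \<open>1 - q^d\<close>; therefore the reflection acts inside a class. It only shows that twice the
  sum is divisible, which suffices since positive integers are units at a prime factor of
  \<open>1 - q^d\<close>. Prime numbers divide no \<open>1 - q^k\<close> and belong to the harmless
  primes. At each prime one factor \<open>1 - q^d\<close> of \<open>d_n\<close> is enough, whence
  the power \<open>A - 1\<close> of \<open>d_n\<close> itself. The constant \<alpha> is the degree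
  count at infinity: the pole \<open>q^(-j)\<close> contributes \<open>A j (n - j) / 2\<close>, at
  most \<open>A n^2 / 8\<close>, and the numerator \<open>(r n)^2 / 2\<close>.\<close>

locale subring_of =
  fixes S :: "'a :: comm_ring_1 set"
  assumes one_mem: "1 \<in> S"
    and diff_mem: "x \<in> S \<Longrightarrow> y \<in> S \<Longrightarrow> x - y \<in> S"
    and mult_mem: "x \<in> S \<Longrightarrow> y \<in> S \<Longrightarrow> x * y \<in> S"
begin

lemma zero_mem: "0 \<in> S"
  using diff_mem[OF one_mem one_mem] by simp

lemma uminus_mem: "x \<in> S \<Longrightarrow> - x \<in> S"
  using diff_mem[OF zero_mem] by simp

lemma add_mem: "x \<in> S \<Longrightarrow> y \<in> S \<Longrightarrow> x + y \<in> S"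
  using diff_mem[of x "- y"] uminus_mem by simp

lemma power_mem: "x \<in> S \<Longrightarrow> x ^ k \<in> S"
  by (induction k) (auto intro: one_mem mult_mem)

lemma sum_mem: "(\<And>i. i \<in> I \<Longrightarrow> f i \<in> S) \<Longrightarrow> sum f I \<in> S"
  by (induction I rule: infinite_finite_induct) (auto intro: zero_mem add_mem)

lemma prod_mem: "(\<And>i. i \<in> I \<Longrightarrow> f i \<in> S) \<Longrightarrow> prod f I \<in> S"
  by (induction I rule: infinite_finite_induct) (auto intro: one_mem mult_mem)

lemma of_nat_mem: "of_nat k \<in> S"
  by (induction k) (auto intro: zero_mem one_mem add_mem)

lemma minus_one_power_mem: "(- 1) ^ k \<in> S"
  by (intro power_mem uminus_mem one_mem)

end

locale subring_mod = subring_of S for S :: "'a :: comm_ring_1 set" +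
  fixes p :: 'a
  assumes modulus_mem: "p \<in> S"
begin

text \<open>Both sides are required to lie in \<open>S\<close>, so that congruences can be
  multiplied without side conditions.\<close>

definition cong_mod :: "'a \<Rightarrow> 'a \<Rightarrow> bool" where
  "cong_mod x y \<longleftrightarrow> x \<in> S \<and> y \<in> S \<and> (\<exists>z\<in>S. x = y + p * z)"

lemma cong_modI: "y \<in> S \<Longrightarrow> z \<in> S \<Longrightarrow> x = y + p * z \<Longrightarrow> cong_mod x y"
  by (auto simp: cong_mod_def intro: add_mem mult_mem modulus_mem)

lemma cong_mod_refl: "x \<in> S \<Longrightarrow> cong_mod x x"
  by (rule cong_modI[of _ 0]) (auto intro: zero_mem)

lemma cong_mod_sym: "cong_mod x y \<Longrightarrow> cong_mod y x"
proof -
  assume "cong_mod x y"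
  then obtain z where "x \<in> S" "z \<in> S" "x = y + p * z"
    by (auto simp: cong_mod_def)
  then show ?thesis by (intro cong_modI[of _ "- z"]) (auto intro: uminus_mem)
qed

lemma cong_mod_add:
  assumes "cong_mod x y" "cong_mod x' y'"
  shows "cong_mod (x + x') (y + y')"
proof -
  obtain z z' where z: "z \<in> S" "x = y + p * z" "z' \<in> S" "x' = y' + p * z'"
    and S: "y \<in> S" "y' \<in> S"
    using assms by (auto simp: cong_mod_def)
  then have "x + x' = (y + y') + p * (z + z')" by (simp add: algebra_simps)
  then show ?thesis using z S by (intro cong_modI[of _ "z + z'"] add_mem) auto
qed

lemma cong_mod_trans:
  assumes "cong_mod x y" "cong_mod y y'"
  shows "cong_mod x y'"
proof -
  obtain z z' where z: "z \<in> S" "x = y + p * z" "z' \<in> S" "y = y' + p * z'" and S: "y' \<in> S"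
    using assms by (auto simp: cong_mod_def)
  then have "x = y' + p * (z + z')" by (simp add: algebra_simps)
  then show ?thesis using z S by (intro cong_modI[of _ "z + z'"] add_mem) auto
qed

lemma cong_mod_mult:
  assumes "cong_mod x y" "cong_mod x' y'"
  shows "cong_mod (x * x') (y * y')"
proof -
  obtain z z' where z: "z \<in> S" "x = y + p * z" "z' \<in> S" "x' = y' + p * z'"
    and S: "y \<in> S" "y' \<in> S" "x' \<in> S"
    using assms by (auto simp: cong_mod_def)
  then have "x * x' = y * y' + p * (z * x' + y * z')" by (simp add: algebra_simps)
  moreover have "z * x' + y * z' \<in> S" "y * y' \<in> S" using z S by (auto intro: add_mem mult_mem)
  ultimately show ?thesis by (intro cong_modI)
qed

lemma cong_mod_uminus: "cong_mod x y \<Longrightarrow> cong_mod (- x) (- y)"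
  using cong_mod_mult[OF cong_mod_refl[OF uminus_mem[OF one_mem]], of x y] by simp

lemma cong_mod_diff: "cong_mod x y \<Longrightarrow> cong_mod x' y' \<Longrightarrow> cong_mod (x - x') (y - y')"
  using cong_mod_add[OF _ cong_mod_uminus, of x y x' y'] by simp

lemma cong_mod_power: "cong_mod x y \<Longrightarrow> cong_mod (x ^ k) (y ^ k)"
  by (induction k) (auto intro: cong_mod_mult cong_mod_refl one_mem)

lemma cong_mod_sum: "(\<And>i. i \<in> I \<Longrightarrow> cong_mod (f i) (g i)) \<Longrightarrow> cong_mod (sum f I) (sum g I)"
  by (induction I rule: infinite_finite_induct) (auto intro: cong_mod_add cong_mod_refl zero_mem)

lemma cong_mod_prod: "(\<And>i. i \<in> I \<Longrightarrow> cong_mod (f i) (g i)) \<Longrightarrow> cong_mod (prod f I) (prod g I)"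
  by (induction I rule: infinite_finite_induct) (auto intro: cong_mod_mult cong_mod_refl one_mem)

lemma cong_mod_inverse:
  assumes "cong_mod x y" "x * x' = 1" "y * y' = 1" "x' \<in> S" "y' \<in> S"
  shows "cong_mod x' y'"
proof -
  have "cong_mod (x' * x * y') (x' * y * y')"
    using assms by (intro cong_mod_mult cong_mod_refl)
  then have "cong_mod (x' * (y * y')) (y' * (x * x'))"
    by (auto simp: mult_ac intro: cong_mod_sym)
  then show ?thesis using assms by simp
qed

lemma cong_mod_zeroI: "z \<in> S \<Longrightarrow> cong_mod (p * z) 0"
  by (rule cong_modI[of _ z]) (auto intro: zero_mem)

end

section \<open>Power series with coefficients in a subring\<close>

definition fps_over :: "'a :: zero set \<Rightarrow> 'a fps set" where
  "fps_over S = {F. \<forall>k. fps_nth F k \<in> S}"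

lemma (in subring_of) subring_of_fps_over: "subring_of (fps_over S)"
  by unfold_locales
     (auto simp: fps_over_def fps_mult_nth intro: diff_mem sum_mem mult_mem zero_mem one_mem)

lemma (in subring_of) fps_const_mem: "x \<in> S \<Longrightarrow> fps_const x \<in> fps_over S"
  by (auto simp: fps_over_def zero_mem)

lemma (in subring_of) fps_X_mem: "fps_X \<in> fps_over S"
  by (auto simp: fps_over_def fps_X_def zero_mem one_mem)

text \<open>The recursion for the coefficients of the inverse divides only by the constant term, so
  strong induction on the index stays inside \<open>S\<close>.\<close>

lemma fps_inverse_mem:
  fixes S :: "'a :: field set"
  assumes "subring_of S" "F \<in> fps_over S" "fps_nth F 0 \<noteq> 0" "inverse (fps_nth F 0) \<in> S"
  shows "inverse F \<in> fps_over S"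
proof -
  interpret subring_of S by fact
  have "fps_nth (inverse F) k \<in> S" for k
  proof (induction k rule: less_induct)
    case (less k)
    show ?case
    proof (cases k)
      case 0
      then show ?thesis using assms by simp
    next
      case (Suc m)
      have "(\<Sum>i=0..k. fps_nth F i * fps_nth (inverse F) (k - i)) = fps_nth (F * inverse F) k"
        by (simp add: fps_mult_nth)
      also have "\<dots> = 0" using assms Suc by (simp add: inverse_mult_eq_1')
      finally have "fps_nth F 0 * fps_nth (inverse F) k
          = - (\<Sum>i=1..k. fps_nth F i * fps_nth (inverse F) (k - i))"
        by (simp add: sum.atLeast_Suc_atMost eq_neg_iff_add_eq_0)
      then have "fps_nth (inverse F) k
          = inverse (fps_nth F 0) * - (\<Sum>i=1..k. fps_nth F i * fps_nth (inverse F) (k - i))"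
        using assms(3) by (metis mult.assoc left_inverse mult_1)
      moreover have "(\<Sum>i=1..k. fps_nth F i * fps_nth (inverse F) (k - i)) \<in> S"
        using assms(2) less by (intro sum_mem mult_mem) (auto simp: fps_over_def)
      ultimately show ?thesis using assms(4) by (simp only: mult_mem uminus_mem)
    qed
  qed
  then show ?thesis by (simp add: fps_over_def)
qed

lemma (in subring_mod) subring_mod_fps: "subring_mod (fps_over S) (fps_const p)"
  using subring_of_fps_over fps_const_mem[OF modulus_mem]
  by (simp add: subring_mod_def subring_mod_axioms_def)

lemma (in subring_mod) cong_mod_fps_nth:
  assumes "subring_mod.cong_mod (fps_over S) (fps_const p) F G"
  shows "cong_mod (fps_nth F k) (fps_nth G k)"
proof -
  interpret f: subring_mod "fps_over S" "fps_const p" by (rule subring_mod_fps)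
  obtain Z where "Z \<in> fps_over S" "G \<in> fps_over S" "F = G + fps_const p * Z"
    using assms by (auto simp: f.cong_mod_def)
  then show ?thesis
    by (intro cong_modI[of _ "fps_nth Z k"]) (auto simp: fps_over_def)
qed

text \<open>Reindexes the multiples of \<open>d\<close> among \<open>u + 1, ..., u + v\<close> by
  their quotients. A constant \<open>h\<close> counts powers of the modulus; a linear
  \<open>h\<close> produces the factors of the classical limit.\<close>

lemma prod_multiples:
  fixes h :: "nat \<Rightarrow> 'a :: comm_monoid_mult"
  assumes "d > 0"
  shows "(\<Prod>i=1..v. if d dvd u + i then h ((u + i) div d) else 1) = prod h {u div d<..(u + v) div d}"
proof (induction v)
  case (Suc v)
  show ?case
  proof (cases "d dvd u + Suc v")
    case True
    then have e: "(u + Suc v) div d = Suc ((u + v) div d)"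
      using div_Suc[of "u + v" d] by (simp add: dvd_eq_mod_eq_0)
    have "u div d \<le> (u + v) div d" by (simp add: div_le_mono)
    then have "{u div d<..Suc ((u + v) div d)} = insert (Suc ((u + v) div d)) {u div d<..(u + v) div d}"
      by auto
    then show ?thesis using Suc True e by (simp add: mult.commute)
  next
    case False
    then have "(u + Suc v) div d = (u + v) div d"
      using div_Suc[of "u + v" d] by (simp add: dvd_eq_mod_eq_0)
    then show ?thesis using Suc False by simp
  qed
qed simp

lemma sum_multiples:
  fixes h :: "nat \<Rightarrow> 'a :: comm_monoid_add"
  assumes "d > 0"
  shows "(\<Sum>i=1..v. if d dvd i then h (i div d) else 0) = sum h {0<..v div d}"
proof (induction v)
  case (Suc v)
  show ?case
  proof (cases "d dvd Suc v")
    case True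
    then have e: "Suc v div d = Suc (v div d)"
      using div_Suc[of v d] by (simp add: dvd_eq_mod_eq_0)
    have "{0<..Suc (v div d)} = insert (Suc (v div d)) {0<..v div d}"
      by auto
    then show ?thesis using Suc True e by (simp add: add.commute)
  next
    case False
    then have "Suc v div d = v div d"
      using div_Suc[of v d] by (simp add: dvd_eq_mod_eq_0)
    then show ?thesis using Suc False by simp
  qed
qed simp

subsection \<open>Partial fractions\<close>

text \<open>Taylor expansion in \<open>X\<close> where \<open>T = a + w X\<close>. The scale
  \<open>w\<close> stays free: \<open>w = 1\<close> serves existence and uniqueness of partial
  fractions, a multiple of the modulus serves the arithmetic.\<close>

definition local_exp :: "'a :: field \<Rightarrow> 'a \<Rightarrow> 'a poly \<Rightarrow> 'a fps" where
  "local_exp a w p = fps_of_poly (pcompose p [:a, w:])"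

lemma local_exp_mult: "local_exp a w (p * p') = local_exp a w p * local_exp a w p'"
  by (simp add: local_exp_def pcompose_mult fps_of_poly_mult)

lemma local_exp_1: "local_exp a w 1 = 1"
  by (simp add: local_exp_def pcompose_1)

lemma local_exp_diff: "local_exp a w (p - p') = local_exp a w p - local_exp a w p'"
  by (simp add: local_exp_def pcompose_diff fps_of_poly_diff)

lemma local_exp_power: "local_exp a w (p ^ k) = local_exp a w p ^ k"
  by (induction k) (simp_all add: local_exp_1 local_exp_mult)

lemma local_exp_sum: "local_exp a w (sum f I) = (\<Sum>i\<in>I. local_exp a w (f i))"
  by (simp add: local_exp_def pcompose_sum fps_of_poly_sum)

lemma local_exp_prod: "local_exp a w (prod f I) = (\<Prod>i\<in>I. local_exp a w (f i))"
  by (simp add: local_exp_def pcompose_prod fps_of_poly_prod)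

lemma local_exp_const: "local_exp a w [:c:] = fps_const c"
  by (simp add: local_exp_def fps_of_poly_const)

lemma local_exp_linear:
  "local_exp a w [:b, c:] = fps_const b + fps_const c * (fps_const a + fps_const w * fps_X)"
  by (simp add: local_exp_def pcompose_pCons fps_of_poly_pCons algebra_simps fps_of_poly_const)

lemma power_linear_dvd_if_local_exp:
  assumes "\<forall>k<m. fps_nth (local_exp a 1 p) k = 0"
  shows "[:- a, 1:] ^ m dvd p"
proof -
  have "monom 1 m dvd pcompose p [:a, 1:]"
    using assms by (simp add: monom_1_dvd_iff' local_exp_def)
  then obtain g where g: "pcompose p [:a, 1:] = monom 1 m * g" by (elim dvdE)
  have "p = pcompose (pcompose p [:a, 1:]) [:- a, 1:]"
    by (simp add: pcompose_assoc[symmetric] pcompose_pCons)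
  also have "\<dots> = pcompose (monom 1 m) [:- a, 1:] * pcompose g [:- a, 1:]"
    by (simp add: g pcompose_mult)
  also have "pcompose (monom 1 m) [:- a, 1:] = [:- a, 1:] ^ m"
  proof (induction m)
    case (Suc m)
    have "monom (1 :: 'a) (Suc m) = [:0, 1:] * monom 1 m" by (simp add: monom_Suc)
    then show ?case using Suc by (simp add: pcompose_mult pcompose_pCons)
  qed (simp add: pcompose_1 monom_0)
  finally show ?thesis by (metis dvd_triv_left)
qed

text \<open>Roots are counted with multiplicity: \<open>card I\<close> distinct points of order at
  least \<open>m\<close> exceed the degree.\<close>

lemma eq_0_if_linear_powers_dvd:
  fixes p :: "'a :: field poly"
  assumes "finite I" "inj_on a I" "\<And>j. j \<in> I \<Longrightarrow> [:- a j, 1:] ^ m dvd p" "degree p < m * card I"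
  shows "p = 0"
proof (rule ccontr)
  assume p: "p \<noteq> 0"
  have "m * card I = (\<Sum>x\<in>a ` I. m)" using assms(1,2) by (simp add: card_image)
  also have "\<dots> \<le> (\<Sum>x\<in>a ` I. order x p)"
    using assms(3) p by (intro sum_mono) (auto simp: order_divides)
  also have "\<dots> = (\<Sum>x\<in>a ` I. count (proots p) x)" using p by simp
  also have "\<dots> = (\<Sum>x\<in>a ` I \<inter> set_mset (proots p). count (proots p) x)"
    using assms(1) by (intro sum.mono_neutral_right) (auto simp del: set_count_proots simp: not_in_iff)
  also have "\<dots> \<le> size (proots p)"
    unfolding size_multiset_overloaded_eq by (intro sum_mono2) auto
  also have "\<dots> \<le> degree p" by (rule size_proots_le)
  finally show False using assms(4) by simp
qed

text \<open>The common denominator divided by \<open>(T - a j)^s\<close>, which turns a partial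
  fraction decomposition into an identity of polynomials.\<close>

definition pfd_term :: "(nat \<Rightarrow> 'a :: field) \<Rightarrow> nat \<Rightarrow> nat \<Rightarrow> nat \<Rightarrow> nat \<Rightarrow> 'a poly" where
  "pfd_term a m n s j = [:- a j, 1:] ^ (m - s) * (\<Prod>i\<in>{0..n} - {j}. [:- a i, 1:]) ^ m"

lemma pfd_iff_poly:
  fixes a :: "nat \<Rightarrow> 'a :: field" and N :: "'a poly"
  shows "to_fract N / (\<Prod>j=0..n. to_fract [:- a j, 1:] ^ m)
      = (\<Sum>s=1..m. \<Sum>j=0..n. to_fract [:c s j:] / to_fract [:- a j, 1:] ^ s)
    \<longleftrightarrow> N = (\<Sum>s=1..m. \<Sum>j=0..n. [:c s j:] * pfd_term a m n s j)"
proof -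
  let ?D = "\<Prod>j=0..n. to_fract [:- a j, 1:] ^ m"
  have prod: "to_fract (prod f I) = (\<Prod>i\<in>I. to_fract (f i))" for f :: "nat \<Rightarrow> 'a poly" and I
    by (induction I rule: infinite_finite_induct) simp_all
  have pow: "to_fract (f ^ k) = to_fract f ^ k" for f :: "'a poly" and k
    by (induction k) simp_all
  have nz: "?D \<noteq> 0" by simp
  have t: "to_fract [:c s j:] / to_fract [:- a j, 1:] ^ s * ?D = to_fract ([:c s j:] * pfd_term a m n s j)"
    if "s \<in> {1..m}" "j \<in> {0..n}" for s j
  proof -
    have "?D = to_fract [:- a j, 1:] ^ m * (\<Prod>i\<in>{0..n} - {j}. to_fract [:- a i, 1:] ^ m)"
      using that by (subst prod.remove[of _ j]) auto
    also have "to_fract [:- a j, 1:] ^ m = to_fract [:- a j, 1:] ^ s * to_fract [:- a j, 1:] ^ (m - s)"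
      using that by (simp flip: power_add)
    finally show ?thesis
      unfolding pfd_term_def to_fract_mult prod pow prod_power_distrib by simp
  qed
  have "(\<Sum>s=1..m. \<Sum>j=0..n. to_fract [:c s j:] / to_fract [:- a j, 1:] ^ s) * ?D
      = to_fract (\<Sum>s=1..m. \<Sum>j=0..n. [:c s j:] * pfd_term a m n s j)"
    unfolding sum_distrib_right to_fract_sum by (intro sum.cong refl t) auto
  then show ?thesis
    using nz by (metis (no_types, lifting) nonzero_eq_divide_eq to_fract_eq_iff)
qed

definition local_cofactor :: "(nat \<Rightarrow> 'a :: field) \<Rightarrow> nat \<Rightarrow> nat \<Rightarrow> 'a \<Rightarrow> 'a fps" where
  "local_cofactor a n j w = (\<Prod>i\<in>{0..n} - {j}. local_exp (a j) w [:- a i, 1:])"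

lemma local_cofactor_unit:
  assumes "inj_on a {0..n}" "j \<le> n"
  shows "fps_nth (local_cofactor a n j w) 0 \<noteq> 0"
proof -
  have "fps_nth (prod f I) 0 = (\<Prod>i\<in>I. fps_nth (f i) 0)" for f :: "nat \<Rightarrow> 'a fps" and I
    by (induction I rule: infinite_finite_induct) simp_all
  then show ?thesis
    using assms by (auto simp: local_cofactor_def local_exp_linear inj_on_def)
qed

text \<open>After division by the cofactor, the terms at the pole \<open>a j\<close> become
  monomials \<open>c s j (w X)^(m - s)\<close>, while the terms at the other poles keep a factor
  \<open>(w X)^m\<close> and do not reach the index \<open>k < m\<close>. Thus the coefficients can
  be read off from a Taylor expansion.\<close>

lemma local_exp_pfd_sum:
  assumes "inj_on a {0..n}" "j \<le> n" "k < m"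
  shows "fps_nth (local_exp (a j) w (\<Sum>s=1..m. \<Sum>i=0..n. [:c s i:] * pfd_term a m n s i)
           * inverse (local_cofactor a n j w) ^ m) k = c (m - k) j * w ^ k"
proof -
  let ?C = "local_cofactor a n j w"
  let ?X = "fps_const w * fps_X"
  let ?e = "local_exp (a j) w"
  have unit: "?C ^ m * inverse ?C ^ m = 1"
    using local_cofactor_unit[OF assms(1,2)]
    by (simp add: inverse_mult_eq_1' flip: power_mult_distrib)
  have lin: "?e [:- a j, 1:] = ?X"
    by (simp add: local_exp_linear flip: fps_const_add)
  have diag: "?e (pfd_term a m n s j) * inverse ?C ^ m = ?X ^ (m - s)" for s
  proof -
    have "?e (pfd_term a m n s j) = ?X ^ (m - s) * ?C ^ m"
      by (simp only: pfd_term_def local_exp_mult local_exp_power local_exp_prod lin local_cofactor_def)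
    then show ?thesis using unit by (simp add: mult.assoc)
  qed
  have off: "fps_nth (?e ([:c s i:] * pfd_term a m n s i) * inverse ?C ^ m) k = 0"
    if "i \<in> {0..n} - {j}" for s i
  proof -
    have "(\<Prod>l\<in>{0..n} - {i}. [:- a l, 1:]) = [:- a j, 1:] * (\<Prod>l\<in>{0..n} - {i} - {j}. [:- a l, 1:])"
      using that assms by (intro prod.remove) auto
    then have "?e ([:c s i:] * pfd_term a m n s i) * inverse ?C ^ m = ?X ^ m *
        (?e [:c s i:] * ?e [:- a i, 1:] ^ (m - s)
          * ?e (\<Prod>l\<in>{0..n} - {i} - {j}. [:- a l, 1:]) ^ m * inverse ?C ^ m)"
      by (simp only: pfd_term_def local_exp_mult local_exp_power power_mult_distrib lin mult_ac)
    then obtain Y where "?e ([:c s i:] * pfd_term a m n s i) * inverse ?C ^ m = ?X ^ m * Y" ..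
    then have "?e ([:c s i:] * pfd_term a m n s i) * inverse ?C ^ m = fps_const (w ^ m) * (fps_X ^ m * Y)"
      by (simp add: power_mult_distrib fps_const_power mult.assoc)
    then show ?thesis using assms(3) by (simp add: fps_X_power_mult_nth)
  qed
  have "fps_nth (?e (\<Sum>s=1..m. \<Sum>i=0..n. [:c s i:] * pfd_term a m n s i) * inverse ?C ^ m) k
      = (\<Sum>s=1..m. \<Sum>i=0..n. fps_nth (?e ([:c s i:] * pfd_term a m n s i) * inverse ?C ^ m) k)"
    by (simp only: local_exp_sum sum_distrib_right fps_sum_nth)
  also have "\<dots> = (\<Sum>s=1..m. fps_nth (?e ([:c s j:] * pfd_term a m n s j) * inverse ?C ^ m) k)"
    using assms(2) off by (intro sum.cong refl) (simp add: sum.remove[of "{0..n}" j])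
  also have "\<dots> = (\<Sum>s=1..m. if s = m - k then c s j * w ^ k else 0)"
  proof (intro sum.cong refl)
    fix s assume s: "s \<in> {1..m}"
    have "?e ([:c s j:] * pfd_term a m n s j) * inverse ?C ^ m = fps_const (c s j) * ?X ^ (m - s)"
      by (simp only: local_exp_mult local_exp_const mult.assoc diag)
    also have "\<dots> = fps_const (c s j * w ^ (m - s)) * fps_X ^ (m - s)"
      by (simp add: power_mult_distrib fps_const_power mult.assoc flip: fps_const_mult)
    finally show "fps_nth (?e ([:c s j:] * pfd_term a m n s j) * inverse ?C ^ m) k
        = (if s = m - k then c s j * w ^ k else 0)"
      using s assms(3) by (auto simp: fps_X_power_nth)
  qed
  also have "\<dots> = c (m - k) j * w ^ k" using assms(3) by simp
  finally show ?thesis .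
qed

lemma degree_pfd_term_less:
  assumes "s \<ge> 1" "s \<le> m" "j \<le> n"
  shows "degree (pfd_term a m n s j) < m * Suc n"
proof -
  have "degree (\<Prod>i\<in>{0..n} - {j}. [:- a i, 1:]) \<le> (\<Sum>i\<in>{0..n} - {j}. degree [:- a i, 1:])"
    using degree_prod_sum_le[of "{0..n} - {j}" "\<lambda>i. [:- a i, 1:]"] by (simp add: comp_def)
  also have "\<dots> = n" using assms by simp
  finally have 1: "degree (\<Prod>i\<in>{0..n} - {j}. [:- a i, 1:]) \<le> n" .
  have "degree (pfd_term a m n s j)
      \<le> degree ([:- a j, 1:] ^ (m - s)) + degree ((\<Prod>i\<in>{0..n} - {j}. [:- a i, 1:]) ^ m)"
    unfolding pfd_term_def by (rule degree_mult_le)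
  also have "\<dots> \<le> (m - s) + n * m"
    using degree_power_le[of "[:- a j, 1:]" "m - s"] 1
      degree_power_le[of "\<Prod>i\<in>{0..n} - {j}. [:- a i, 1:]" m] mult_le_mono1[OF 1, of m]
    by (intro add_mono) (auto intro: order_trans)
  also have "\<dots> < m * Suc n" using assms by (simp add: mult.commute)
  finally show ?thesis .
qed

text \<open>By \<open>local_exp_pfd_sum\<close> the Taylor coefficients at the poles are the only
  candidates. With them the difference of both sides vanishes to order \<open>m\<close> at
  \<open>n + 1\<close> points, too often for its degree.\<close>

lemma pfd_exists:
  assumes inj: "inj_on a {0..n}" and deg: "degree N < m * Suc n"
  shows "\<exists>c. (\<forall>s j. s \<notin> {1..m} \<or> j \<notin> {0..n} \<longrightarrow> c s j = 0)
    \<and> N = (\<Sum>s=1..m. \<Sum>j=0..n. [:c s j:] * pfd_term a m n s j)"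
proof -
  define c where "c s j = (if s \<in> {1..m} \<and> j \<in> {0..n} then
      fps_nth (local_exp (a j) 1 N * inverse (local_cofactor a n j 1) ^ m) (m - s) else 0)" for s j
  let ?S = "\<Sum>s=1..m. \<Sum>j=0..n. [:c s j:] * pfd_term a m n s j"
  have "N - ?S = 0"
  proof (rule eq_0_if_linear_powers_dvd[OF _ inj])
    have "degree ?S < m * Suc n"
    proof (intro degree_sum_less)
      fix s j assume "s \<in> {1..m}" "j \<in> {0..n}"
      then show "degree ([:c s j:] * pfd_term a m n s j) < m * Suc n"
        using degree_pfd_term_less[of s m j n a] by (cases "c s j = 0") auto
    qed (use deg in auto)
    then show "degree (N - ?S) < m * card {0..n}"
      using deg degree_diff_le_max[of N ?S] by simp
  next
    fix j assume j: "j \<in> {0..n}"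
    let ?C = "local_cofactor a n j 1"
    show "[:- a j, 1:] ^ m dvd N - ?S"
    proof (rule power_linear_dvd_if_local_exp, intro allI impI)
      fix k assume k: "k < m"
      have z: "fps_nth (local_exp (a j) 1 (N - ?S) * inverse ?C ^ m) i = 0" if "i < m" for i
        using that j local_exp_pfd_sum[OF inj, of j i m 1 c]
        by (simp add: local_exp_diff left_diff_distrib c_def)
      have "inverse ?C ^ m * ?C ^ m = 1"
        using local_cofactor_unit[OF inj, of j 1] j
        by (simp add: inverse_mult_eq_1 flip: power_mult_distrib)
      then have eq: "local_exp (a j) 1 (N - ?S) = (local_exp (a j) 1 (N - ?S) * inverse ?C ^ m) * ?C ^ m"
        by (simp only: mult.assoc mult_1_right)
      have "fps_nth (local_exp (a j) 1 (N - ?S)) k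
          = (\<Sum>i=0..k. fps_nth (local_exp (a j) 1 (N - ?S) * inverse ?C ^ m) i * fps_nth (?C ^ m) (k - i))"
        by (subst eq, rule fps_mult_nth)
      also have "\<dots> = 0" using k z by (intro sum.neutral) auto
      finally show "fps_nth (local_exp (a j) 1 (N - ?S)) k = 0" .
    qed
  qed simp
  then show ?thesis by (intro exI[of _ c]) (auto simp: c_def)
qed

subsection \<open>Local expansions at the poles\<close>

text \<open>After the substitution \<open>T = q\<^bsup>-j\<^esup> (1 + p X)\<close> every linear factor of the numerator and of the
  denominator becomes, up to a power of \<open>q\<close>, one of the following series.\<close>

definition q_factor :: "'a :: field \<Rightarrow> 'a \<Rightarrow> int \<Rightarrow> 'a fps" where
  "q_factor q p k = 1 - fps_const (q powi k) * (1 + fps_const p * fps_X)"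

definition up_factors :: "'a :: field \<Rightarrow> 'a \<Rightarrow> nat \<Rightarrow> nat \<Rightarrow> 'a fps" where
  "up_factors q p u v = (\<Prod>i=1..v. q_factor q p (int (u + i)))"

definition down_factors :: "'a :: field \<Rightarrow> 'a \<Rightarrow> nat \<Rightarrow> nat \<Rightarrow> 'a fps" where
  "down_factors q p u v = (\<Prod>i=1..v. q_factor q p (- int (u + i)))"

text \<open>For \<open>A = 2 a\<close> this is \<open>(A - 2 r) n / 2 + A / 2 - 2\<close>; if
  \<open>0 < r < a\<close> then \<open>a \<ge> 2\<close>, so the subtraction does not
  truncate.\<close>

definition T_exponent :: "nat \<Rightarrow> nat \<Rightarrow> nat \<Rightarrow> nat" where
  "T_exponent a r n = (a - r) * n + a - 2"

text \<open>At \<open>T = q^(-j) (1 + p X)\<close> this is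
  \<open>q^(j (2 a - 1)) (T - q^(-j))^(2 a)\<close> times the rational function. The power of
  \<open>q\<close> in front gives the coefficients the factor \<open>q^(j (s - 1))\<close> that
  occurs in \<open>P0_tilde\<close>. The base \<open>q\<close> is an arbitrary field element, so
  that \<open>1/q\<close> can be inserted later.\<close>

definition pole_series :: "'a :: field \<Rightarrow> 'a \<Rightarrow> nat \<Rightarrow> nat \<Rightarrow> nat \<Rightarrow> nat \<Rightarrow> 'a fps" where
  "pole_series q p a r n j =
     fps_const (q powi (- (int j * (int (T_exponent a r n) + 1))) * qpoch q q n ^ (2 * (a - r)))
     * (1 + fps_const p * fps_X) ^ T_exponent a r n
     * down_factors q p j (r * n) * up_factors q p (n - j) (r * n)
     * inverse (down_factors q p 0 j * up_factors q p 0 (n - j)) ^ (2 * a)"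

lemma prod_split_at:
  fixes f :: "int \<Rightarrow> 'a :: comm_monoid_mult"
  assumes "j \<le> n"
  shows "(\<Prod>i\<in>{0..n} - {j}. f (int i - int j)) = (\<Prod>i=1..j. f (- int i)) * (\<Prod>i=1..n - j. f (int i))"
proof -
  have "{0..n} - {j} = {..<j} \<union> {j<..n}" using assms by auto
  moreover have "(\<Prod>i\<in>{..<j}. f (int i - int j)) = (\<Prod>i=1..j. f (- int i))"
    by (rule prod.reindex_bij_witness[of _ "\<lambda>i. j - i" "\<lambda>i. j - i"]) auto
  moreover have "(\<Prod>i\<in>{j<..n}. f (int i - int j)) = (\<Prod>i=1..n - j. f (int i))"
    by (rule prod.reindex_bij_witness[of _ "\<lambda>i. i + j" "\<lambda>i. i - j"]) (use assms in auto)
  moreover have "{..<j} \<inter> {j<..n} = {}" by auto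
  ultimately show ?thesis by (simp add: prod.union_disjoint)
qed

lemma fps_const_prod: "fps_const (prod f I) = (\<Prod>i\<in>I. fps_const (f i :: 'a :: field))"
  by (induction I rule: infinite_finite_induct) (simp_all flip: fps_const_mult)

lemma double_sum_upto: "2 * (\<Sum>i=0..n. int i) = int n * (int n + 1)"
  by (induction n) (simp_all add: algebra_simps)

lemma qq_power_neq_1:
  assumes "k > 0"
  shows "qq ^ k \<noteq> 1"
proof -
  have "qq ^ k = to_fract (monom 1 k)"
  proof (induction k)
    case (Suc k)
    have "monom (1 :: rat) (Suc k) = [:0, 1:] * monom 1 k" by (simp add: monom_Suc)
    then show ?case using Suc by (simp only: to_fract_mult power_Suc qq_def)
  qed (simp add: monom_0 flip: one_pCons)
  moreover have "monom (1 :: rat) k \<noteq> 1"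
    using assms degree_monom_eq[of "1 :: rat" k] by (metis degree_1 neq0_conv one_neq_zero)
  ultimately show ?thesis by (metis to_fract_1 to_fract_eq_iff)
qed

lemma qq_powi_neq_1:
  assumes "k \<noteq> 0"
  shows "qq powi k \<noteq> 1"
proof (cases "k > 0")
  case True
  then show ?thesis using qq_power_neq_1[of "nat k"] by (simp add: power_int_def)
next
  case False
  then show ?thesis using assms qq_power_neq_1[of "nat (- k)"]
    by (simp add: power_int_def power_inverse)
qed

lemma qq_powi_add: "qq powi (k + l) = qq powi k * qq powi l"
  using qq_nonzero by (simp add: power_int_add)

lemma qq_powi_inj: "qq powi k = qq powi l \<Longrightarrow> k = l"
  using qq_powi_neq_1[of "k - l"] qq_nonzero by (auto simp: power_int_diff)

definition pole :: "nat \<Rightarrow> ratfun" where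
  "pole j = qq powi (- int j)"

lemma inj_pole: "inj_on pole I"
  by (auto simp: inj_on_def pole_def dest: qq_powi_inj)

definition R_numerator :: "nat \<Rightarrow> nat \<Rightarrow> nat \<Rightarrow> ratfun poly" where
  "R_numerator a r n =
     [:qq powi (- (int a * int n * (int n + 1))) * qpoch qq qq n ^ (2 * (a - r)):]
     * [:0, 1:] ^ T_exponent a r n
     * (\<Prod>i=1..r * n. [:1, - (qq powi (- int i)):])
     * (\<Prod>i=1..r * n. [:1, - (qq powi int (n + i)):])"

lemma to_fract_prod: "to_fract (prod f I) = (\<Prod>i\<in>I. to_fract (f i))"
  by (induction I rule: infinite_finite_induct) simp_all

lemma to_fract_power: "to_fract (x ^ k) = to_fract x ^ k"
  by (induction k) simp_all

lemma TT_minus_const_T: "TT - const_T x = to_fract [:- x, 1:]"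
  by (simp add: TT_def const_T_def flip: to_fract_diff)

lemma one_minus_const_T_TT: "1 - const_T x * TT = to_fract [:1, - x:]"
proof -
  have "1 - const_T x * TT = to_fract (1 - [:x:] * [:0, 1:])"
    by (simp only: TT_def const_T_def to_fract_diff to_fract_mult to_fract_1)
  then show ?thesis by (simp add: one_pCons)
qed

lemma const_T_mult: "const_T (x * y) = const_T x * const_T y"
  by (simp add: const_T_def flip: to_fract_mult)

lemma const_T_power: "const_T (x ^ k) = const_T x ^ k"
  by (induction k) (simp_all add: const_T_mult, simp add: const_T_def flip: one_pCons)

lemma R_tilde_eq:
  assumes "0 < r" "r < a"
  shows "R_tilde (2 * a) r n
    = to_fract (R_numerator a r n) / (\<Prod>j=0..n. to_fract [:- pole j, 1:] ^ (2 * a))"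
proof -
  have e1: "(int (2 * a) - 2 * int r) * int n div 2 + int (2 * a) div 2 - 2 = int (T_exponent a r n)"
  proof -
    have "(int (2 * a) - 2 * int r) * int n = 2 * (int (a - r) * int n)"
      using assms by (simp add: of_nat_diff algebra_simps)
    moreover have "(a - r) * n + a \<ge> 2" using assms by simp
    ultimately show ?thesis
      unfolding \<open>(int (2 * a) - 2 * int r) * int n = 2 * (int (a - r) * int n)\<close>
      by (simp add: T_exponent_def of_nat_diff)
  qed
  have e2: "int (2 * a) * int n * (int n + 1) div 2 = int a * int n * (int n + 1)"
    by simp
  have 1: "qpoch (const_T (qq powi (- (int r * int n))) * TT) (const_T qq) (r * n)
      = (\<Prod>i=1..r * n. to_fract [:1, - (qq powi (- int i)):])"
  proof -
    have "qpoch (const_T (qq powi (- (int r * int n))) * TT) (const_T qq) (r * n)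
        = (\<Prod>i<r * n. 1 - const_T (qq powi (- (int r * int n)) * qq ^ i) * TT)"
      by (simp add: qpoch_def const_T_mult const_T_power mult_ac)
    \<comment> \<open>Read backwards, the exponents \<open>- r n + i\<close> with
      \<open>i < r n\<close> are the \<open>- i\<close> with
      \<open>1 \<le> i \<le> r n\<close>.\<close>
    also have "\<dots> = (\<Prod>i=1..r * n. 1 - const_T (qq powi (- int i)) * TT)"
    proof (rule prod.reindex_bij_witness[of _ "\<lambda>i. r * n - i" "\<lambda>i. r * n - i"])
      fix i assume "i \<in> {..<r * n}"
      then have "- int (r * n - i) = - (int r * int n) + int i" by (simp add: of_nat_diff)
      then have "qq powi (- int (r * n - i)) = qq powi (- (int r * int n)) * qq ^ i"
        by (simp only: qq_powi_add power_int_of_nat)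
      then show "1 - const_T (qq powi (- int (r * n - i))) * TT
          = 1 - const_T (qq powi (- (int r * int n)) * qq ^ i) * TT" by simp
    qed auto
    finally show ?thesis by (simp only: one_minus_const_T_TT)
  qed
  have 2: "qpoch (const_T (qq ^ (n + 1)) * TT) (const_T qq) (r * n)
      = (\<Prod>i=1..r * n. to_fract [:1, - (qq powi int (n + i)):])"
  proof -
    have "qpoch (const_T (qq ^ (n + 1)) * TT) (const_T qq) (r * n)
        = (\<Prod>i<r * n. 1 - const_T (qq ^ (n + 1) * qq ^ i) * TT)"
      by (simp add: qpoch_def const_T_mult const_T_power mult_ac)
    also have "\<dots> = (\<Prod>i=1..r * n. 1 - const_T (qq powi int (n + i)) * TT)"
    proof (rule prod.reindex_bij_witness[of _ "\<lambda>i. i - 1" "\<lambda>i. i + 1"])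
      fix i
      have "qq powi int (n + (i + 1)) = qq ^ (n + 1) * qq ^ i"
        unfolding power_int_of_nat power_add by (simp add: mult_ac)
      then show "1 - const_T (qq powi int (n + (i + 1))) * TT = 1 - const_T (qq ^ (n + 1) * qq ^ i) * TT"
        by simp
    qed auto
    finally show ?thesis by (simp only: one_minus_const_T_TT)
  qed
  have ex: "2 * a - 2 * r = 2 * (a - r)" by simp
  show ?thesis
    unfolding R_tilde_def e1 e2 1 2 R_numerator_def TT_minus_const_T ex pole_def[symmetric]
    by (simp only: to_fract_mult to_fract_prod to_fract_power power_int_of_nat TT_def[symmetric]
        const_T_def[symmetric] const_T_mult times_divide_eq_right mult_ac)
qed

text \<open>Properness of the fraction, as required by \<open>pfd_exists\<close>: the degree is at
  most \<open>(a + r) n + a - 2\<close>, and \<open>r < a\<close>.\<close>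

lemma degree_R_numerator:
  assumes "0 < r" "r < a"
  shows "degree (R_numerator a r n) < 2 * a * Suc n"
proof -
  have d: "degree (\<Prod>i=1..r * n. [:1, - f i:]) \<le> r * n" for f :: "nat \<Rightarrow> ratfun"
  proof -
    have "degree (\<Prod>i=1..r * n. [:1, - f i:]) \<le> (\<Sum>i=1..r * n. degree [:1, - f i:])"
      using degree_prod_sum_le[of "{1..r * n}" "\<lambda>i. [:1, - f i:]"] by (simp add: comp_def)
    also have "\<dots> \<le> (\<Sum>i=1..r * n. 1)" by (intro sum_mono) simp
    finally show ?thesis by simp
  qed
  have m: "degree (x * y) \<le> k + l" if "degree x \<le> k" "degree y \<le> l" for x y :: "ratfun poly" and k l
    using degree_mult_le[of x y] that by simp
  have "degree ([:0, 1 :: ratfun:] ^ T_exponent a r n) \<le> T_exponent a r n"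
    using degree_power_le[of "[:0, 1 :: ratfun:]"] by simp
  then have "degree (R_numerator a r n) \<le> 0 + T_exponent a r n + r * n + r * n"
    unfolding R_numerator_def by (intro m d) auto
  also have "0 + T_exponent a r n + r * n + r * n < 2 * a * Suc n"
  proof -
    have "(a - r) * n + r * n = a * n"
      using assms by (simp flip: add_mult_distrib)
    moreover have "r * n \<le> a * n" "2 * a * Suc n = 2 * a + 2 * (a * n)" using assms by simp_all
    ultimately show ?thesis using assms unfolding T_exponent_def by linarith
  qed
  finally show ?thesis .
qed

text \<open>A factor \<open>1 - q^k T\<close> becomes the \<open>q_factor\<close> of index
  \<open>k - j\<close>, so both windows of the numerator are shifted by \<open>j\<close>.\<close>

lemma local_exp_R_numerator:
  assumes "j \<le> n"
  shows "local_exp (pole j) (pole j * p) (R_numerator a r n)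
    = fps_const (qq powi (- (int a * int n * (int n + 1)) - int j * int (T_exponent a r n))
        * qpoch qq qq n ^ (2 * (a - r)))
      * (1 + fps_const p * fps_X) ^ T_exponent a r n
      * down_factors qq p j (r * n) * up_factors qq p (n - j) (r * n)"
proof -
  have l: "local_exp (pole j) (pole j * p) [:1, - (qq powi k):] = q_factor qq p (k - int j)" for k
    using qq_nonzero
    by (simp add: local_exp_linear q_factor_def pole_def power_int_diff power_int_minus
        divide_inverse algebra_simps flip: fps_const_mult fps_const_neg)
  have "local_exp (pole j) (pole j * p) [:0, 1:] = fps_const (pole j) * (1 + fps_const p * fps_X)"
    by (simp add: local_exp_linear algebra_simps flip: fps_const_mult)
  then have t: "local_exp (pole j) (pole j * p) [:0, 1:] ^ T_exponent a r n
      = fps_const (qq powi (- (int j * int (T_exponent a r n)))) * (1 + fps_const p * fps_X) ^ T_exponent a r n"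
    by (simp add: power_mult_distrib fps_const_power pole_def power_int_power')
  have d: "(\<Prod>i=1..r * n. local_exp (pole j) (pole j * p) [:1, - (qq powi (- int i)):])
      = down_factors qq p j (r * n)"
    unfolding l down_factors_def by (intro prod.cong refl) (simp add: algebra_simps)
  have u: "(\<Prod>i=1..r * n. local_exp (pole j) (pole j * p) [:1, - (qq powi int (n + i)):])
      = up_factors qq p (n - j) (r * n)"
    unfolding l up_factors_def using assms by (intro prod.cong refl) (simp add: of_nat_diff)
  show ?thesis
    unfolding R_numerator_def local_exp_mult local_exp_power local_exp_prod local_exp_const t d u
    using qq_nonzero by (simp add: power_int_diff power_int_minus divide_inverse mult_ac flip: fps_const_mult)
qed

text \<open>Writing \<open>T - q^(-i)\<close> as \<open>- q^(-i) (1 - q^i T)\<close> reduces the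
  cofactor to the same series as the numerator. The signs disappear in the even power
  \<open>2 * a\<close>.\<close>

lemma local_cofactor_pole:
  assumes "j \<le> n"
  shows "inverse (local_cofactor pole n j (pole j * p)) ^ (2 * a)
    = fps_const (qq powi (int a * int n * (int n + 1) - 2 * int a * int j))
      * inverse (down_factors qq p 0 j * up_factors qq p 0 (n - j)) ^ (2 * a)"
proof -
  have l: "local_exp (pole j) (pole j * p) [:- pole i, 1:]
      = fps_const (- pole i) * q_factor qq p (int i - int j)" for i
    using qq_nonzero
    by (simp add: local_exp_linear q_factor_def pole_def power_int_diff power_int_minus field_simps
        flip: fps_const_mult fps_const_neg)
  have "local_cofactor pole n j (pole j * p)
      = fps_const (\<Prod>i\<in>{0..n} - {j}. - pole i) * (down_factors qq p 0 j * up_factors qq p 0 (n - j))"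
    unfolding local_cofactor_def l prod.distrib fps_const_prod[symmetric] prod_split_at[OF assms]
    by (simp add: down_factors_def up_factors_def)
  then have "inverse (local_cofactor pole n j (pole j * p)) ^ (2 * a)
      = fps_const (inverse (\<Prod>i\<in>{0..n} - {j}. - pole i) ^ (2 * a))
        * inverse (down_factors qq p 0 j * up_factors qq p 0 (n - j)) ^ (2 * a)"
    by (simp only: fps_inverse_mult power_mult_distrib fps_const_inverse fps_const_power)
  moreover have "inverse (\<Prod>i\<in>{0..n} - {j}. - pole i) ^ (2 * a)
      = qq powi (int a * int n * (int n + 1) - 2 * int a * int j)"
  proof -
    have s: "(\<Prod>i\<in>I. pole i) = qq powi (- (\<Sum>i\<in>I. int i))" for I
      by (induction I rule: infinite_finite_induct)
         (use qq_nonzero in \<open>simp_all add: pole_def power_int_add[symmetric]\<close>)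
    have "2 * (\<Sum>i\<in>{0..n} - {j}. int i) = int n * (int n + 1) - 2 * int j"
      using assms double_sum_upto[of n] by (simp add: sum_diff1)
    then have "(\<Sum>i\<in>{0..n} - {j}. int i) * (2 * int a) = int a * int n * (int n + 1) - 2 * int a * int j"
      by (simp add: algebra_simps)
         (metis (no_types, lifting) distrib_left mult.assoc mult.commute mult.left_commute right_diff_distrib)
    moreover have "inverse (\<Prod>i\<in>{0..n} - {j}. - pole i) ^ (2 * a)
        = inverse (\<Prod>i\<in>{0..n} - {j}. pole i) ^ (2 * a)"
    proof -
      have "((- 1 :: ratfun) ^ k) ^ (2 * a) = 1" for k
        by (simp add: power_mult power2_eq_square flip: power_mult_distrib)
      then show ?thesis by (simp add: prod_uminus power_mult_distrib power_inverse)
    qed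
    ultimately show ?thesis
      by (simp add: s power_int_minus power_int_power' flip: power_int_mult)
  qed
  ultimately show ?thesis by simp
qed

text \<open>Resolves the definite description: existence follows from the degree bound, uniqueness
  because the expansions with \<open>w = 1\<close> determine every \<open>c s j\<close>.\<close>

lemma c_tilde_pfd:
  assumes "0 < r" "r < a"
  shows "R_numerator a r n
    = (\<Sum>s=1..2 * a. \<Sum>j=0..n. [:c_tilde (2 * a) r n s j:] * pfd_term pole (2 * a) n s j)"
proof -
  let ?P = "\<lambda>c. (\<forall>s j. s \<notin> {1..2 * a} \<or> j \<notin> {0..n} \<longrightarrow> c s j = 0) \<and>
     R_tilde (2 * a) r n =
       (\<Sum>s=1..2 * a. \<Sum>j=0..n. const_T (c s j) / (TT - const_T (qq powi (- int j))) ^ s)"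
  have iff: "?P c \<longleftrightarrow> (\<forall>s j. s \<notin> {1..2 * a} \<or> j \<notin> {0..n} \<longrightarrow> c s j = 0) \<and>
      R_numerator a r n = (\<Sum>s=1..2 * a. \<Sum>j=0..n. [:c s j:] * pfd_term pole (2 * a) n s j)" for c
    unfolding pfd_iff_poly[symmetric] R_tilde_eq[OF assms] TT_minus_const_T pole_def
    by (simp only: const_T_def)
  have "\<exists>!c. ?P c"
  proof (rule ex_ex1I)
    show "\<exists>c. ?P c"
      unfolding iff using pfd_exists[OF inj_pole degree_R_numerator[OF assms]] .
  next
    fix c c' assume "?P c" "?P c'"
    note c = this[unfolded iff]
    show "c = c'"
    proof (intro ext)
      fix s j
      show "c s j = c' s j"
      proof (cases "s \<in> {1..2 * a} \<and> j \<in> {0..n}")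
        case True
        then have "2 * a - s < 2 * a" "j \<le> n" "2 * a - (2 * a - s) = s" by auto
        then show ?thesis
          using local_exp_pfd_sum[OF inj_pole, of j n "2 * a - s" "2 * a" 1 c]
            local_exp_pfd_sum[OF inj_pole, of j n "2 * a - s" "2 * a" 1 c'] c by simp
      qed (use c in auto)
    qed
  qed
  then have "?P (c_tilde (2 * a) r n)"
    unfolding c_tilde_def by (rule theI')
  then show ?thesis unfolding iff by simp
qed

text \<open>Scaling the local variable by \<open>p\<close> multiplies the coefficient of order
  \<open>s\<close> by \<open>p^(2 a - s)\<close>. Integrality of a series therefore bounds the
  denominators of all \<open>c_tilde\<close> at that pole simultaneously.\<close>

lemma pole_series_nth:
  assumes "0 < r" "r < a" "j \<le> n" "1 \<le> s" "s \<le> 2 * a"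
  shows "fps_nth (pole_series qq p a r n j) (2 * a - s)
    = qq powi (int j * (int s - 1)) * p ^ (2 * a - s) * c_tilde (2 * a) r n s j"
proof -
  have s: "2 * a - s < 2 * a" "2 * a - (2 * a - s) = s" using assms by auto
  have "local_exp (pole j) (pole j * p) (R_numerator a r n)
        * inverse (local_cofactor pole n j (pole j * p)) ^ (2 * a)
      = fps_const (qq powi (- (int j * (2 * int a - 1)))) * pole_series qq p a r n j"
  \<comment> \<open>The powers of \<open>q\<close> with exponent \<open>a n (n + 1)\<close> from
    numerator and cofactor cancel; only exponents proportional to \<open>j\<close> remain.\<close>
  proof -
    have "(- (int a * int n * (int n + 1)) - int j * int (T_exponent a r n))
          + (int a * int n * (int n + 1) - 2 * int a * int j)
        = - (int j * (2 * int a - 1)) + - (int j * (int (T_exponent a r n) + 1))"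
      by (simp add: algebra_simps)
    then have "qq powi (- (int a * int n * (int n + 1)) - int j * int (T_exponent a r n))
          * qq powi (int a * int n * (int n + 1) - 2 * int a * int j)
        = qq powi (- (int j * (2 * int a - 1))) * qq powi (- (int j * (int (T_exponent a r n) + 1)))"
      unfolding qq_powi_add[symmetric] by (rule arg_cong)
    then have e: "fps_const (qq powi (- (int a * int n * (int n + 1)) - int j * int (T_exponent a r n)))
          * fps_const (qq powi (int a * int n * (int n + 1) - 2 * int a * int j))
        = fps_const (qq powi (- (int j * (2 * int a - 1))))
          * fps_const (qq powi (- (int j * (int (T_exponent a r n) + 1))))"
      by simp
    show ?thesis
      unfolding local_exp_R_numerator[OF assms(3)] local_cofactor_pole[OF assms(3)] pole_series_def
        fps_const_mult[symmetric]
      using e by (simp only: mult_ac)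
  qed
  then have "c_tilde (2 * a) r n s j * (pole j * p) ^ (2 * a - s)
      = qq powi (- (int j * (2 * int a - 1))) * fps_nth (pole_series qq p a r n j) (2 * a - s)"
    using local_exp_pfd_sum[OF inj_pole assms(3) s(1), of "pole j * p" "c_tilde (2 * a) r n"]
    unfolding c_tilde_pfd[OF assms(1,2), symmetric] s(2) by simp
  note eq = this
  have unit: "qq powi (int j * (2 * int a - 1)) * qq powi (- (int j * (2 * int a - 1))) = 1"
    by (simp flip: qq_powi_add)
  have "fps_nth (pole_series qq p a r n j) (2 * a - s)
      = (qq powi (int j * (2 * int a - 1)) * qq powi (- (int j * (2 * int a - 1))))
        * fps_nth (pole_series qq p a r n j) (2 * a - s)"
    by (simp only: unit mult_1_left)
  also have "\<dots> = qq powi (int j * (2 * int a - 1)) * (c_tilde (2 * a) r n s j * (pole j * p) ^ (2 * a - s))"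
    by (simp only: mult.assoc eq)
  also have "\<dots> = qq powi (int j * (2 * int a - 1)) * pole j ^ (2 * a - s) * p ^ (2 * a - s)
      * c_tilde (2 * a) r n s j"
    by (simp only: power_mult_distrib mult_ac)
  also have "qq powi (int j * (2 * int a - 1)) * pole j ^ (2 * a - s) = qq powi (int j * (int s - 1))"
    using qq_nonzero assms
    by (simp add: pole_def power_int_power' power_int_add[symmetric] of_nat_diff algebra_simps)
  finally show ?thesis .
qed

subsection \<open>The substitution of \<open>1/q\<close> for \<open>q\<close>\<close>

text \<open>Provides the shape to which \<open>subst_inv_q_divide\<close> applies; this is how the
  substitution is shown to be a ring homomorphism.\<close>

lemma ratfun_cases:
  obtains a b where "b \<noteq> 0" "f = rat_poly_at a qq / rat_poly_at b qq"
proof -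
  have "f = Fract (fst (quot_of_fract f)) (snd (quot_of_fract f))"
    by (simp add: Fract_quot_of_fract)
  then have "f = rat_poly_at (fst (quot_of_fract f)) qq / rat_poly_at (snd (quot_of_fract f)) qq"
    by (simp add: Fract_conv_to_fract to_fract_eq_rat_poly_at)
  then show ?thesis using that snd_quot_of_fract_nonzero by blast
qed

lemma rat_poly_at_add: "rat_poly_at (p + p') x = rat_poly_at p x + rat_poly_at p' x"
proof -
  have "map_poly of_rat (p + p') = map_poly of_rat p + (map_poly of_rat p' :: ratfun poly)"
    by (rule poly_eqI) (simp add: coeff_map_poly of_rat_add)
  then show ?thesis by (simp add: rat_poly_at_def)
qed

lemma rat_poly_at_1: "rat_poly_at 1 x = 1"
  by (simp add: rat_poly_at_def)

lemma rat_poly_at_qq_nonzero: "p \<noteq> 0 \<Longrightarrow> rat_poly_at p qq \<noteq> 0"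
  by (simp flip: to_fract_eq_rat_poly_at)

lemma subst_inv_q_mult: "subst_inv_q (f * g) = subst_inv_q f * subst_inv_q g"
proof -
  obtain a b where 1: "b \<noteq> 0" "f = rat_poly_at a qq / rat_poly_at b qq" by (rule ratfun_cases)
  obtain c d where 2: "d \<noteq> 0" "g = rat_poly_at c qq / rat_poly_at d qq" by (rule ratfun_cases)
  have "f * g = rat_poly_at (a * c) qq / rat_poly_at (b * d) qq"
    by (simp add: 1 2 rat_poly_at_mult)
  then show ?thesis
    using 1 2 subst_inv_q_divide[of b a] subst_inv_q_divide[of d c] subst_inv_q_divide[of "b * d" "a * c"]
    by (simp add: rat_poly_at_mult)
qed

lemma subst_inv_q_add: "subst_inv_q (f + g) = subst_inv_q f + subst_inv_q g"
proof -
  obtain a b where 1: "b \<noteq> 0" "f = rat_poly_at a qq / rat_poly_at b qq" by (rule ratfun_cases)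
  obtain c d where 2: "d \<noteq> 0" "g = rat_poly_at c qq / rat_poly_at d qq" by (rule ratfun_cases)
  have "f + g = rat_poly_at (a * d + c * b) qq / rat_poly_at (b * d) qq"
    using 1(1) 2(1) by (simp add: 1(2) 2(2) rat_poly_at_mult rat_poly_at_add rat_poly_at_qq_nonzero
        add_frac_eq mult.commute)
  then show ?thesis
    using 1 2 subst_inv_q_divide[of b a] subst_inv_q_divide[of d c]
      subst_inv_q_divide[of "b * d" "a * d + c * b"]
    by (simp add: rat_poly_at_mult rat_poly_at_add rat_poly_at_inv_q_nonzero add_frac_eq mult.commute)
qed

lemma subst_inv_q_1: "subst_inv_q 1 = 1"
  using subst_inv_q_divide[of 1 1] by (simp add: rat_poly_at_1)

lemma subst_inv_q_0: "subst_inv_q 0 = 0"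
  using subst_inv_q_add[of 0 0] by simp

lemma subst_inv_q_uminus: "subst_inv_q (- f) = - subst_inv_q f"
  using subst_inv_q_add[of f "- f"] by (simp add: subst_inv_q_0 eq_neg_iff_add_eq_0 add.commute)

lemma subst_inv_q_diff: "subst_inv_q (f - g) = subst_inv_q f - subst_inv_q g"
  using subst_inv_q_add[of f "- g"] by (simp add: subst_inv_q_uminus)

lemma subst_inv_q_qq: "subst_inv_q qq = inverse qq"
  using subst_inv_q_divide[of 1 "[:0, 1:]"]
  by (simp add: rat_poly_at_1) (simp add: rat_poly_at_def map_poly_pCons divide_inverse)

lemma subst_inv_q_inverse: "subst_inv_q (inverse f) = inverse (subst_inv_q f)"
proof (cases "f = 0")
  case False
  then have "subst_inv_q f * subst_inv_q (inverse f) = 1"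
    by (simp add: subst_inv_q_1 flip: subst_inv_q_mult)
  then show ?thesis by (metis inverse_unique)
qed (simp add: subst_inv_q_0)

lemma subst_inv_q_div: "subst_inv_q (f / g) = subst_inv_q f / subst_inv_q g"
  by (simp add: divide_inverse subst_inv_q_mult subst_inv_q_inverse)

lemma subst_inv_q_power: "subst_inv_q (f ^ k) = subst_inv_q f ^ k"
  by (induction k) (simp_all add: subst_inv_q_1 subst_inv_q_mult)

lemma subst_inv_q_powi: "subst_inv_q (f powi k) = subst_inv_q f powi k"
  by (simp add: power_int_def subst_inv_q_power subst_inv_q_inverse)

lemma subst_inv_q_sum: "subst_inv_q (sum f I) = (\<Sum>i\<in>I. subst_inv_q (f i))"
  by (induction I rule: infinite_finite_induct) (simp_all add: subst_inv_q_0 subst_inv_q_add)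

lemma subst_inv_q_prod: "subst_inv_q (prod f I) = (\<Prod>i\<in>I. subst_inv_q (f i))"
  by (induction I rule: infinite_finite_induct) (simp_all add: subst_inv_q_1 subst_inv_q_mult)

definition fps_subst_inv_q :: "ratfun fps \<Rightarrow> ratfun fps" where
  "fps_subst_inv_q F = Abs_fps (\<lambda>k. subst_inv_q (fps_nth F k))"

lemma fps_subst_inv_q_mult: "fps_subst_inv_q (F * G) = fps_subst_inv_q F * fps_subst_inv_q G"
  by (rule fps_ext) (simp add: fps_subst_inv_q_def fps_mult_nth subst_inv_q_sum subst_inv_q_mult)

lemma fps_subst_inv_q_const: "fps_subst_inv_q (fps_const c) = fps_const (subst_inv_q c)"
  by (rule fps_ext) (simp add: fps_subst_inv_q_def subst_inv_q_0)

lemma fps_subst_inv_q_1: "fps_subst_inv_q 1 = 1"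
  using fps_subst_inv_q_const[of 1] by (simp add: subst_inv_q_1)

lemma fps_subst_inv_q_X: "fps_subst_inv_q fps_X = fps_X"
  by (rule fps_ext) (simp add: fps_subst_inv_q_def fps_X_def subst_inv_q_0 subst_inv_q_1)

lemma fps_subst_inv_q_add: "fps_subst_inv_q (F + G) = fps_subst_inv_q F + fps_subst_inv_q G"
  by (rule fps_ext) (simp add: fps_subst_inv_q_def subst_inv_q_add)

lemma fps_subst_inv_q_diff: "fps_subst_inv_q (F - G) = fps_subst_inv_q F - fps_subst_inv_q G"
  by (rule fps_ext) (simp add: fps_subst_inv_q_def subst_inv_q_diff)

lemma fps_subst_inv_q_power: "fps_subst_inv_q (F ^ k) = fps_subst_inv_q F ^ k"
  by (induction k) (simp_all add: fps_subst_inv_q_1 fps_subst_inv_q_mult)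

lemma fps_subst_inv_q_prod: "fps_subst_inv_q (prod f I) = (\<Prod>i\<in>I. fps_subst_inv_q (f i))"
  by (induction I rule: infinite_finite_induct) (simp_all add: fps_subst_inv_q_1 fps_subst_inv_q_mult)

lemma fps_subst_inv_q_inverse:
  assumes "fps_nth F 0 \<noteq> 0"
  shows "fps_subst_inv_q (inverse F) = inverse (fps_subst_inv_q F)"
proof -
  have "fps_subst_inv_q F * fps_subst_inv_q (inverse F) = 1"
    using assms by (simp add: inverse_mult_eq_1' fps_subst_inv_q_1 flip: fps_subst_inv_q_mult)
  then show ?thesis by (metis fps_inverse_unique)
qed

lemma fps_prod_nth_0: "fps_nth (prod f I) 0 = (\<Prod>i\<in>I. fps_nth (f i) 0)"
  by (induction I rule: infinite_finite_induct) simp_all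

lemma factors_nth_0_nonzero:
  assumes "\<And>k. k \<noteq> 0 \<Longrightarrow> q powi k \<noteq> 1"
  shows "fps_nth (down_factors q p 0 j * up_factors q p 0 l) 0 \<noteq> 0"
proof -
  have "fps_nth (q_factor q p k) 0 \<noteq> 0" if "k \<noteq> 0" for k
    using assms[OF that] by (simp add: q_factor_def)
  then show ?thesis by (auto simp: down_factors_def up_factors_def fps_prod_nth_0)
qed

lemma fps_subst_inv_q_q_factor:
  "fps_subst_inv_q (q_factor qq p k) = q_factor (inverse qq) (subst_inv_q p) k"
  by (simp add: q_factor_def fps_subst_inv_q_diff fps_subst_inv_q_mult fps_subst_inv_q_add
      fps_subst_inv_q_1 fps_subst_inv_q_const fps_subst_inv_q_X subst_inv_q_powi subst_inv_q_qq)

lemma subst_inv_q_qpoch: "subst_inv_q (qpoch x y k) = qpoch (subst_inv_q x) (subst_inv_q y) k"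
  by (simp add: qpoch_def subst_inv_q_prod subst_inv_q_diff subst_inv_q_1 subst_inv_q_mult
      subst_inv_q_power)

text \<open>The scale 1 is taken because the substitution fixes it.\<close>

lemma fps_subst_inv_q_pole_series:
  "fps_subst_inv_q (pole_series qq 1 a r n j) = pole_series (inverse qq) 1 a r n j"
proof -
  have u: "fps_subst_inv_q (up_factors qq 1 k l) = up_factors (inverse qq) 1 k l"
    and d: "fps_subst_inv_q (down_factors qq 1 k l) = down_factors (inverse qq) 1 k l" for k l
    by (simp_all add: up_factors_def down_factors_def fps_subst_inv_q_prod fps_subst_inv_q_q_factor
        subst_inv_q_1)
  have i: "fps_subst_inv_q (inverse (down_factors qq 1 0 j * up_factors qq 1 0 (n - j)))
      = inverse (down_factors (inverse qq) 1 0 j * up_factors (inverse qq) 1 0 (n - j))"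
    by (subst fps_subst_inv_q_inverse, rule factors_nth_0_nonzero, erule qq_powi_neq_1)
       (simp add: u d fps_subst_inv_q_mult)
  show ?thesis
    unfolding pole_series_def fps_subst_inv_q_mult fps_subst_inv_q_power fps_subst_inv_q_const u d i
    by (simp add: fps_subst_inv_q_add fps_subst_inv_q_1 fps_subst_inv_q_X subst_inv_q_mult
        subst_inv_q_powi subst_inv_q_qq subst_inv_q_power subst_inv_q_qpoch)
qed

text \<open>Since \<open>1 - q^(-i) = - q^(-i) (1 - q^i)\<close>, the two symbols differ by a sign
  and a power of \<open>q\<close>. Squaring removes the sign and the half in the exponent, and
  \<open>pole_series\<close> contains only an even power.\<close>

lemma qpoch_inverse_square:
  fixes q :: "'a :: field"
  assumes "q \<noteq> 0"
  shows "qpoch (inverse q) (inverse q) n ^ 2 = q powi (- (int n * (int n + 1))) * qpoch q q n ^ 2"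
proof (induction n)
  case (Suc n)
  have S: "qpoch x x (Suc n) = qpoch x x n * (1 - x ^ Suc n)" for x :: 'a
    by (simp add: qpoch_def)
  have "(1 - inverse q ^ Suc n) ^ 2 = (inverse (q ^ Suc n) * (q ^ Suc n - 1)) ^ 2"
    using assms by (simp add: right_diff_distrib power_inverse del: power_Suc)
  also have "\<dots> = q powi (- (2 * (int n + 1))) * (1 - q ^ Suc n) ^ 2"
  proof -
    have "q powi (- (2 * (int n + 1))) = q powi (- int (2 * Suc n))" by (simp add: algebra_simps)
    also have "\<dots> = inverse (q ^ Suc n) ^ 2"
      unfolding power_int_minus power_int_of_nat
      by (simp only: power_inverse mult.commute[of 2] power_mult)
    finally show ?thesis by (simp only: power_mult_distrib power2_commute)
  qed
  finally have "qpoch (inverse q) (inverse q) (Suc n) ^ 2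
      = (q powi (- (int n * (int n + 1))) * q powi (- (2 * (int n + 1)))) * qpoch q q (Suc n) ^ 2"
    unfolding S power_mult_distrib Suc.IH by (simp only: mult_ac)
  also have "q powi (- (int n * (int n + 1))) * q powi (- (2 * (int n + 1)))
      = q powi (- (int (Suc n) * (int (Suc n) + 1)))"
    using assms by (simp add: power_int_add[symmetric] algebra_simps)
  finally show ?case .
qed (simp add: qpoch_def)

text \<open>Inverting \<open>q\<close> exchanges upward and downward windows and hence the roles of
  \<open>j\<close> and \<open>n - j\<close>. The remaining exponent \<open>n (r - 1)\<close> is
  independent of \<open>j\<close> and is the one built into \<open>P0_hat\<close>.\<close>

lemma pole_series_inverse:
  fixes q :: "'a :: field"
  assumes "q \<noteq> 0" "j \<le> n" "0 < r" "r < a"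
  shows "pole_series (inverse q) p a r n j
    = fps_const (q powi (int n * (int r - 1))) * pole_series q p a r n (n - j)"
proof -
  have f: "q_factor (inverse q) p k = q_factor q p (- k)" for k
    by (simp add: q_factor_def power_int_inverse power_int_minus)
  have u: "up_factors (inverse q) p k l = down_factors q p k l"
    and d: "down_factors (inverse q) p k l = up_factors q p k l" for k l
    by (simp_all add: up_factors_def down_factors_def f add.commute)
  have P: "qpoch (inverse q) (inverse q) n ^ (2 * (a - r))
      = q powi (- (int n * (int n + 1) * int (a - r))) * qpoch q q n ^ (2 * (a - r))"
    by (simp add: power_mult qpoch_inverse_square[OF assms(1)] power_mult_distrib power_int_power')
  let ?M = "int (T_exponent a r n) + 1"
  have M: "?M = int (a - r) * int n + int a - 1"
    using assms by (simp add: T_exponent_def of_nat_diff)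
  have "int j * ?M + - (int n * (int n + 1) * int (a - r))
      = int n * (int r - 1) + - (int (n - j) * ?M)"
    unfolding M using assms by (simp add: of_nat_diff algebra_simps)
  then have "q powi (int j * ?M) * q powi (- (int n * (int n + 1) * int (a - r)))
      = q powi (int n * (int r - 1)) * q powi (- (int (n - j) * ?M))"
    using assms(1) by (metis power_int_add)
  then have "inverse q powi (- (int j * ?M)) * qpoch (inverse q) (inverse q) n ^ (2 * (a - r))
      = q powi (int n * (int r - 1)) * (q powi (- (int (n - j) * ?M)) * qpoch q q n ^ (2 * (a - r)))"
    unfolding P by (simp add: power_int_inverse power_int_minus flip: mult.assoc)
  then have "fps_const (inverse q powi (- (int j * ?M)) * qpoch (inverse q) (inverse q) n ^ (2 * (a - r)))
      = fps_const (q powi (int n * (int r - 1)))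
        * fps_const (q powi (- (int (n - j) * ?M)) * qpoch q q n ^ (2 * (a - r)))"
    by simp
  then show ?thesis
    using assms(2) by (simp only: pole_series_def u d mult_ac diff_diff_cancel)
qed

subsection \<open>A formula for \<open>P0_hat\<close>\<close>

definition b_coeff :: "nat \<Rightarrow> nat \<Rightarrow> nat \<Rightarrow> nat \<Rightarrow> nat \<Rightarrow> ratfun" where
  "b_coeff a r n s j = qq powi (int j * (int s - 1)) * c_tilde (2 * a) r n s j"

lemma b_coeff_eq:
  assumes "0 < r" "r < a" "j \<le> n" "1 \<le> s" "s \<le> 2 * a"
  shows "p ^ (2 * a - s) * b_coeff a r n s j = fps_nth (pole_series qq p a r n j) (2 * a - s)"
  by (simp add: pole_series_nth[OF assms] b_coeff_def)

lemma subst_inv_q_b_coeff: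
  assumes "0 < r" "r < a" "j \<le> n" "1 \<le> s" "s \<le> 2 * a"
  shows "subst_inv_q (b_coeff a r n s j) = qq powi (int n * (int r - 1)) * b_coeff a r n s (n - j)"
proof -
  have "subst_inv_q (b_coeff a r n s j)
      = fps_nth (fps_subst_inv_q (pole_series qq 1 a r n j)) (2 * a - s)"
    using b_coeff_eq[OF assms, of 1] by (simp add: fps_subst_inv_q_def)
  also have "\<dots> = qq powi (int n * (int r - 1)) * fps_nth (pole_series qq 1 a r n (n - j)) (2 * a - s)"
    using pole_series_inverse[of qq j n r a 1] assms qq_nonzero
    by (simp add: fps_subst_inv_q_pole_series)
  also have "fps_nth (pole_series qq 1 a r n (n - j)) (2 * a - s) = b_coeff a r n s (n - j)"
    using b_coeff_eq[of r a "n - j" n s 1] assms by simp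
  finally show ?thesis .
qed

text \<open>The first sum is the weight in \<open>P0_tilde\<close> at \<open>z = 1\<close>; the
  second is its image under \<open>q -> 1/q\<close> and \<open>j -> n - j\<close>.\<close>

definition P0_weight :: "nat \<Rightarrow> nat \<Rightarrow> nat \<Rightarrow> ratfun" where
  "P0_weight n s j = (\<Sum>k=1..j. (-1) ^ s * (qq ^ k / (1 - qq ^ k) ^ s))
     - (\<Sum>k=1..n - j. qq ^ (k * (s - 1)) / (1 - qq ^ k) ^ s)"

text \<open>The prefactor \<open>q^(- n (r - 1))\<close> cancels the one from
  \<open>subst_inv_q_b_coeff\<close>, so the term at \<open>1/q\<close> is a combination of the same
  \<open>b_coeff\<close>. The derivative of \<open>P1_tilde\<close> supplies the sum with
  \<open>s = 1\<close>.\<close>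

lemma P0_hat_eq:
  assumes "0 < r" "r < a"
  shows "P0_hat (2 * a) r n = (\<Sum>s=1..2 * a. \<Sum>j=0..n. b_coeff a r n s j * P0_weight n s j)
    + (\<Sum>j=0..n. of_nat j * b_coeff a r n 1 j)"
proof -
  let ?b = "b_coeff a r n"
  let ?w = "\<lambda>s k. (-1) ^ s * (qq ^ k / (1 - qq ^ k) ^ s)"
  let ?w' = "\<lambda>s k. qq ^ (k * (s - 1)) / (1 - qq ^ k) ^ s"
  have P0: "poly (P0_tilde (2 * a) r n) 1 = (\<Sum>s=1..2 * a. \<Sum>j=0..n. ?b s j * (\<Sum>k=1..j. ?w s k))"
  proof -
    have "(\<Sum>k=1..j. (-1) ^ s * (qq powi (int k - int j * (1 - int s)) / (1 - qq ^ k) ^ s) * c_tilde (2 * a) r n s j)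
        = ?b s j * (\<Sum>k=1..j. ?w s k)" for s j
      unfolding sum_distrib_left
    proof (intro sum.cong refl)
      fix k
      have "int k - int j * (1 - int s) = int k + int j * (int s - 1)" by (simp add: algebra_simps)
      then have "qq powi (int k - int j * (1 - int s)) = qq ^ k * qq powi (int j * (int s - 1))"
        by (simp only: qq_powi_add power_int_of_nat)
      then show "(-1) ^ s * (qq powi (int k - int j * (1 - int s)) / (1 - qq ^ k) ^ s) * c_tilde (2 * a) r n s j
          = ?b s j * ?w s k"
        by (simp add: b_coeff_def)
    qed
    then have "poly (P0_tilde (2 * a) r n) 1 = (\<Sum>s=1..2 * a. \<Sum>j=1..n. ?b s j * (\<Sum>k=1..j. ?w s k))"
      by (simp add: P0_tilde_def poly_sum poly_monom)
    also have "\<dots> = (\<Sum>s=1..2 * a. \<Sum>j=0..n. ?b s j * (\<Sum>k=1..j. ?w s k))"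
      by (intro sum.cong refl sum.mono_neutral_left) auto
    finally show ?thesis .
  qed
  have w: "subst_inv_q (?w s k) = ?w' s k" if "1 \<le> s" "1 \<le> k" for s k
  proof -
    have "1 - inverse qq ^ k = (-1) * inverse (qq ^ k) * (1 - qq ^ k)"
      using qq_nonzero by (simp add: algebra_simps power_inverse)
    then have "subst_inv_q (?w s k) = (-1) ^ s * (inverse (qq ^ k) / ((-1) * inverse (qq ^ k) * (1 - qq ^ k)) ^ s)"
      by (simp add: subst_inv_q_mult subst_inv_q_power subst_inv_q_uminus subst_inv_q_1
          subst_inv_q_div subst_inv_q_qq subst_inv_q_diff power_inverse)
    also have "\<dots> = ((-1) ^ s * (-1) ^ s) * (inverse (qq ^ k) * (qq ^ k) ^ s) / (1 - qq ^ k) ^ s"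
    proof -
      have "inverse ((-1 :: ratfun) ^ s) = (-1) ^ s" by (simp flip: power_inverse)
      then show ?thesis
        by (simp only: power_mult_distrib divide_inverse inverse_mult_distrib power_inverse
            inverse_inverse_eq mult_ac)
    qed
    also have "(-1 :: ratfun) ^ s * (-1) ^ s = 1" by (simp flip: power_mult_distrib)
    also have "inverse (qq ^ k) * (qq ^ k) ^ s = qq ^ (k * (s - 1))"
    proof -
      have "(qq ^ k) ^ s = qq ^ k * qq ^ (k * (s - 1))"
        using that by (cases s) (simp_all add: power_mult)
      then show ?thesis using qq_nonzero by simp
    qed
    finally show ?thesis by simp
  qed
  have "qq powi (- (int n * (int r - 1))) * subst_inv_q (poly (P0_tilde (2 * a) r n) 1)
      = (\<Sum>s=1..2 * a. \<Sum>j=0..n. ?b s (n - j) * (\<Sum>k=1..j. ?w' s k))"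
  proof -
    have "qq powi (- (int n * (int r - 1))) * (subst_inv_q (?b s j) * subst_inv_q (\<Sum>k=1..j. ?w s k))
        = ?b s (n - j) * (\<Sum>k=1..j. ?w' s k)" if "s \<in> {1..2 * a}" "j \<in> {0..n}" for s j
    proof -
      have "subst_inv_q (\<Sum>k=1..j. ?w s k) = (\<Sum>k=1..j. ?w' s k)"
        unfolding subst_inv_q_sum using that by (intro sum.cong refl w) auto
      moreover have "qq powi (- (int n * (int r - 1))) * subst_inv_q (?b s j) = ?b s (n - j)"
        using that assms qq_nonzero by (simp add: subst_inv_q_b_coeff power_int_minus)
      ultimately show ?thesis by (simp only: mult.assoc[symmetric])
    qed
    note summand = this
    define W where "W s j = (\<Sum>k=1..j. ?w s k)" for s j
    have "qq powi (- (int n * (int r - 1))) * subst_inv_q (poly (P0_tilde (2 * a) r n) 1)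
        = (\<Sum>s=1..2 * a. \<Sum>j=0..n. qq powi (- (int n * (int r - 1)))
            * (subst_inv_q (?b s j) * subst_inv_q (W s j)))"
      unfolding P0 W_def[symmetric] subst_inv_q_sum subst_inv_q_mult sum_distrib_left ..
    also have "\<dots> = (\<Sum>s=1..2 * a. \<Sum>j=0..n. ?b s (n - j) * (\<Sum>k=1..j. ?w' s k))"
      unfolding W_def by (intro sum.cong refl summand)
    finally show ?thesis .
  qed
  also have "\<dots> = (\<Sum>s=1..2 * a. \<Sum>j=0..n. ?b s j * (\<Sum>k=1..n - j. ?w' s k))"
    by (intro sum.cong refl sum.reindex_bij_witness[of _ "\<lambda>j. n - j" "\<lambda>j. n - j"]) auto
  finally have P0': "qq powi (- (int n * (int r - 1))) * subst_inv_q (poly (P0_tilde (2 * a) r n) 1)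
      = (\<Sum>s=1..2 * a. \<Sum>j=0..n. ?b s j * (\<Sum>k=1..n - j. ?w' s k))" .
  have P1: "poly (pderiv (P1_tilde (2 * a) r n)) 1 = - (\<Sum>j=0..n. of_nat j * ?b 1 j)"
  proof -
    have "pderiv (sum f I) = (\<Sum>i\<in>I. pderiv (f i))" for f :: "nat \<Rightarrow> ratfun poly" and I
      by (induction I rule: infinite_finite_induct) (simp_all add: pderiv_add)
    then show ?thesis
      by (simp add: P1_tilde_def pderiv_minus pderiv_monom poly_sum poly_monom b_coeff_def)
  qed
  show ?thesis
    unfolding P0_hat_def P0' P1 unfolding P0 P0_weight_def
    by (simp add: right_diff_distrib sum_subtractf)
qed

subsection \<open>Division with remainder\<close>

lemma div_add_div_le: "x div d + y div d \<le> (x + y) div (d :: nat)"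
  by (simp add: div_add1_eq[of x y])

lemma mult_div_le_div_mult: "r * (n div d) \<le> r * n div (d :: nat)"
proof (cases "d = 0")
  case False
  have "r * (n div d) * d \<le> r * n" by (simp add: mult.assoc)
  then show ?thesis using False by (simp add: less_eq_div_iff_mult_less_eq)
qed simp

text \<open>The exponent of the modulus in a pole series: multiples of \<open>d\<close> in the
  numerator, the power of \<open>(q)_n\<close> included, minus those in the denominator. By
  \<open>pole_order_gap_add\<close> the last subtraction does not truncate in the range of
  interest.\<close>

definition pole_order_gap :: "nat \<Rightarrow> nat \<Rightarrow> nat \<Rightarrow> nat \<Rightarrow> nat \<Rightarrow> nat" where
  "pole_order_gap d a r n j = 2 * (a - r) * (n div d) + ((j + r * n) div d - j div d)
     + ((n - j + r * n) div d - (n - j) div d) - 2 * a * (j div d + (n - j) div d)"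

text \<open>A window of length \<open>r n\<close> contains at least \<open>r (n div d)\<close>
  multiples of \<open>d\<close>, and the two quotients in the denominator add up to at most
  \<open>n div d\<close>. A vanishing balance forces both windows to be minimal.\<close>

lemma pole_order_gap:
  assumes "r < a" "j \<le> n"
  shows pole_order_gap_add: "pole_order_gap d a r n j + 2 * a * (j div d + (n - j) div d)
      = 2 * (a - r) * (n div d) + ((j + r * n) div d - j div d) + ((n - j + r * n) div d - (n - j) div d)"
      (is ?A)
    and pole_order_gap_0: "pole_order_gap d a r n j = 0 \<Longrightarrow>
      (j + r * n) div d = j div d + r * (n div d)
      \<and> (n - j + r * n) div d = (n - j) div d + r * (n div d)" (is "_ \<Longrightarrow> ?B")
proof -
  define N where "N = n div d"
  define L where "L = j div d + (n - j) div d"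
  define z1 where "z1 = (j + r * n) div d - j div d"
  define z2 where "z2 = (n - j + r * n) div d - (n - j) div d"
  have L: "L \<le> N" using div_add_div_le[of j d "n - j"] assms by (simp add: L_def N_def)
  have z: "r * N \<le> (x + r * n) div d - x div d" for x
    using div_add_div_le[of x d "r * n"] mult_div_le_div_mult[of r n d] by (simp add: N_def)
  have z1: "r * N \<le> z1" and z2: "r * N \<le> z2" using z by (simp_all add: z1_def z2_def)
  have aL: "a * L \<le> a * N" using L by simp
  have aN: "(a - r) * N + r * N = a * N" using assms by (simp flip: add_mult_distrib)
  have le: "2 * a * L \<le> 2 * (a - r) * N + z1 + z2"
    using aL aN z1 z2 unfolding mult.assoc by linarith
  then show ?A
    by (simp add: pole_order_gap_def N_def L_def z1_def z2_def)
  assume "pole_order_gap d a r n j = 0"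
  then have "2 * (a - r) * N + z1 + z2 \<le> 2 * a * L"
    by (simp add: pole_order_gap_def N_def L_def z1_def z2_def)
  then have "z1 = r * N" "z2 = r * N" using aL aN z1 z2 unfolding mult.assoc by linarith+
  moreover have "x div d \<le> (x + r * n) div d" for x by (simp add: div_le_mono)
  ultimately show ?B by (metis N_def z1_def z2_def add.commute le_add_diff_inverse2)
qed

text \<open>Reflection of the residue class of \<open>j\<close> modulo \<open>d\<close> inside \<open>{0..n}\<close>.\<close>

definition class_reflect :: "nat \<Rightarrow> nat \<Rightarrow> nat \<Rightarrow> nat" where
  "class_reflect d n j = j mod d + d * ((n - j) div d)"

text \<open>With \<open>j = \<rho> + d l\<close> and \<open>n - j = \<sigma> + d m\<close> the
  reflected index is \<open>\<rho> + d m\<close> and its complement \<open>\<sigma> + d l\<close>: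
  the quotients trade places, the remainders stay.\<close>

lemma class_reflect:
  assumes "d > 0" "j \<le> n"
  shows class_reflect_le: "class_reflect d n j \<le> n"
    and class_reflect_mod: "class_reflect d n j mod d = j mod d"
    and class_reflect_div: "class_reflect d n j div d = (n - j) div d"
    and class_reflect_co_mod: "(n - class_reflect d n j) mod d = (n - j) mod d"
    and class_reflect_co_div: "(n - class_reflect d n j) div d = j div d"
    and class_reflect_class_reflect: "class_reflect d n (class_reflect d n j) = j"
proof -
  have j: "j = j mod d + d * (j div d)" and nj: "n - j = (n - j) mod d + d * ((n - j) div d)"
    by simp_all
  then have n: "n = class_reflect d n j + ((n - j) mod d + d * (j div d))"
    unfolding class_reflect_def using assms(2) by linarith
  show "class_reflect d n j \<le> n" using n by linarith
  show m: "class_reflect d n j mod d = j mod d" by (simp add: class_reflect_def)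
  show "class_reflect d n j div d = (n - j) div d" using assms(1) by (simp add: class_reflect_def)
  have co: "n - class_reflect d n j = (n - j) mod d + d * (j div d)" using n by linarith
  show "(n - class_reflect d n j) mod d = (n - j) mod d" by (simp add: co)
  show dv: "(n - class_reflect d n j) div d = j div d" using assms(1) by (simp add: co)
  show "class_reflect d n (class_reflect d n j) = j"
    unfolding class_reflect_def[of d n "class_reflect d n j"] m dv by simp
qed

text \<open>The number of multiples of \<open>d\<close> in a window depends on its start only modulo
  \<open>d\<close>, and the quotients enter symmetrically.\<close>

lemma pole_order_gap_class_reflect:
  assumes "d > 0" "j \<le> n"
  shows "pole_order_gap d a r n (class_reflect d n j) = pole_order_gap d a r n j"
proof -
  have "(x + r * n) div d - x div d = r * n div d + (x mod d + r * n mod d) div d" for x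
    by (simp add: div_add1_eq[of x])
  note z = this
  show ?thesis
    unfolding pole_order_gap_def z unfolding class_reflect[OF assms] by (simp add: add_ac)
qed

subsection \<open>Local integrality\<close>

lemma inverse_prod: "inverse (prod f I) = (\<Prod>i\<in>I. inverse (f i :: 'a :: field))"
  by (induction I rule: infinite_finite_induct) simp_all

text \<open>In the application \<open>S\<close> is the localisation at a prime dividing \<open>1 - q\<^sup>d\<close>, with \<open>d\<close> minimal, and
  \<open>p = 1 - q\<^sup>d\<close>; primes dividing no \<open>1 - q\<^sup>k\<close> with \<open>1 \<le> k \<le> n\<close> are covered by \<open>d = 1\<close>, \<open>p = 1\<close>.\<close>

locale local_data = subring_mod S p for S :: "'a :: field set" and p :: 'a +
  fixes q :: 'a and d n :: nat
  assumes p_nonzero: "p \<noteq> 0"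
    and q_nonzero: "q \<noteq> 0"
    and q_mem: "q \<in> S"
    and inverse_q_mem: "inverse q \<in> S"
    and d_pos: "d > 0"
    and q_powi_neq_1: "\<And>k :: int. k \<noteq> 0 \<Longrightarrow> q powi k \<noteq> 1"
    and multiple_mem: "\<And>k :: int. int d dvd k \<Longrightarrow> (1 - q powi k) / p \<in> S"
    and nonmultiple_unit: "\<And>k :: nat. 1 \<le> k \<Longrightarrow> k \<le> n \<Longrightarrow> \<not> d dvd k \<Longrightarrow> inverse (1 - q ^ k) \<in> S"
    and multiple_unit: "\<And>k :: nat. 1 \<le> k \<Longrightarrow> k \<le> n \<Longrightarrow> d dvd k \<Longrightarrow> p / (1 - q ^ k) \<in> S"
begin

sublocale F: subring_mod "fps_over S" "fps_const p"
  by (rule subring_mod_fps)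

lemma q_powi_mem: "q powi k \<in> S"
  unfolding power_int_def using q_mem inverse_q_mem by (auto intro: power_mem)

lemma q_powi_add: "q powi (k + l) = q powi k * q powi l"
  using q_nonzero by (simp add: power_int_add)

lemma one_minus_q_powi_uminus: "1 - q powi (- k) = - (q powi (- k) * (1 - q powi k))"
  using q_nonzero by (simp add: algebra_simps flip: q_powi_add)

lemma inverse_one_minus_mem:
  assumes "1 \<le> k" "k \<le> n" "\<not> d dvd k"
  shows "inverse (1 - q powi (int k)) \<in> S" "inverse (1 - q powi (- int k)) \<in> S"
proof -
  show 1: "inverse (1 - q powi (int k)) \<in> S"
    using nonmultiple_unit[OF assms] by simp
  have "inverse (1 - q powi (- int k)) = - (q powi (int k) * inverse (1 - q powi (int k)))"
    unfolding one_minus_q_powi_uminus by (simp add: power_int_minus)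
  then show "inverse (1 - q powi (- int k)) \<in> S"
    using 1 by (simp only: uminus_mem mult_mem q_powi_mem)
qed

lemma p_div_one_minus_mem:
  assumes "1 \<le> k" "k \<le> n" "d dvd k"
  shows "p / (1 - q powi (int k)) \<in> S" "p / (1 - q powi (- int k)) \<in> S"
proof -
  show 1: "p / (1 - q powi (int k)) \<in> S"
    using multiple_unit[OF assms] by simp
  have "p / (1 - q powi (- int k)) = - (q powi (int k) * (p / (1 - q powi (int k))))"
    unfolding one_minus_q_powi_uminus by (simp add: power_int_minus divide_inverse)
  then show "p / (1 - q powi (- int k)) \<in> S"
    using 1 by (simp only: uminus_mem mult_mem q_powi_mem)
qed

lemma p_div_one_minus_mem': "1 \<le> k \<Longrightarrow> k \<le> n \<Longrightarrow> p / (1 - q ^ k) \<in> S"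
  using p_div_one_minus_mem[of k] inverse_one_minus_mem[of k] modulus_mem
  by (cases "d dvd k") (auto simp: divide_inverse intro: mult_mem)

text \<open>The series \<open>q_factor q p k\<close> without its forced factor: for \<open>d\<close>
  dividing \<open>k\<close> both \<open>1 - q^k\<close> and the coefficient \<open>p q^k\<close> of
  \<open>X\<close> are multiples of \<open>p\<close>.\<close>

definition reduced :: "int \<Rightarrow> 'a fps" where
  "reduced k = (if int d dvd k then fps_const ((1 - q powi k) / p) - fps_const (q powi k) * fps_X
     else q_factor q p k)"

lemma q_factor_eq_reduced: "q_factor q p k = fps_const (if int d dvd k then p else 1) * reduced k"
proof (cases "int d dvd k")
  case True
  have "fps_const p * fps_const ((1 - q powi k) / p) = 1 - fps_const (q powi k)"
    using p_nonzero by (simp add: fps_const_1_eq_1[symmetric] del: fps_const_1_eq_1)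
  then show ?thesis using True
    by (simp add: reduced_def q_factor_def right_diff_distrib algebra_simps flip: fps_const_mult)
qed (simp add: reduced_def)

lemma reduced_mem: "reduced k \<in> fps_over S"
proof (cases "int d dvd k")
  case True
  then show ?thesis unfolding reduced_def
    by (auto intro!: F.diff_mem F.mult_mem fps_const_mem fps_X_mem multiple_mem q_powi_mem)
next
  case False
  then show ?thesis unfolding reduced_def q_factor_def
    by (auto intro!: F.diff_mem F.mult_mem F.add_mem F.one_mem fps_const_mem fps_X_mem q_powi_mem modulus_mem)
qed

definition reduced_up :: "nat \<Rightarrow> nat \<Rightarrow> 'a fps" where
  "reduced_up u v = (\<Prod>i=1..v. reduced (int (u + i)))"

definition reduced_down :: "nat \<Rightarrow> nat \<Rightarrow> 'a fps" where
  "reduced_down u v = (\<Prod>i=1..v. reduced (- int (u + i)))"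

lemma prod_p_power:
  "(\<Prod>i=1..v. fps_const (if d dvd u + i then p else 1)) = fps_const p ^ ((u + v) div d - u div d)"
  using prod_multiples[OF d_pos, where u = u and v = v and h = "\<lambda>_. fps_const p"]
  by (simp add: if_distrib[of fps_const] cong: if_cong)

lemma up_factors_eq: "up_factors q p u v = fps_const p ^ ((u + v) div d - u div d) * reduced_up u v"
  unfolding up_factors_def q_factor_eq_reduced prod.distrib reduced_up_def int_dvd_int_iff
    prod_p_power ..

lemma down_factors_eq: "down_factors q p u v = fps_const p ^ ((u + v) div d - u div d) * reduced_down u v"
  unfolding down_factors_def q_factor_eq_reduced prod.distrib reduced_down_def dvd_minus_iff
    int_dvd_int_iff prod_p_power ..

lemma reduced_up_mem: "reduced_up u v \<in> fps_over S"
  and reduced_down_mem: "reduced_down u v \<in> fps_over S"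
  unfolding reduced_up_def reduced_down_def by (auto intro!: F.prod_mem reduced_mem)

lemma reduced_unit:
  assumes "1 \<le> i" "i \<le> n" "k = int i \<or> k = - int i"
  shows "fps_nth (reduced k) 0 \<noteq> 0 \<and> inverse (fps_nth (reduced k) 0) \<in> S"
proof -
  have "1 - q powi k \<noteq> 0" using q_powi_neq_1[of k] assms by auto
  moreover have "fps_nth (reduced k) 0 = (if d dvd i then (1 - q powi k) / p else 1 - q powi k)"
    using assms(3) by (auto simp: reduced_def q_factor_def)
  ultimately show ?thesis
    using assms p_nonzero p_div_one_minus_mem[of i] inverse_one_minus_mem[of i] by auto
qed

lemma reduced_denominator_unit:
  assumes "j \<le> n"
  shows "fps_nth (reduced_down 0 j * reduced_up 0 (n - j)) 0 \<noteq> 0"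
    and "inverse (reduced_down 0 j * reduced_up 0 (n - j)) \<in> fps_over S"
proof -
  let ?D = "reduced_down 0 j * reduced_up 0 (n - j)"
  have u: "fps_nth (reduced k) 0 \<noteq> 0" "inverse (fps_nth (reduced k) 0) \<in> S"
    if "i \<in> {1..j} \<and> k = - int i \<or> i \<in> {1..n - j} \<and> k = int i" for i k
  proof -
    have "i \<le> n" using that assms by auto
    then show "fps_nth (reduced k) 0 \<noteq> 0" "inverse (fps_nth (reduced k) 0) \<in> S"
      using reduced_unit[of i k] that by auto
  qed
  have e: "fps_nth ?D 0 = (\<Prod>i=1..j. fps_nth (reduced (- int i)) 0)
      * (\<Prod>i=1..n - j. fps_nth (reduced (int i)) 0)"
    by (simp add: reduced_down_def reduced_up_def fps_prod_nth_0)
  have "fps_nth (reduced (- int i)) 0 \<noteq> 0" if "i \<in> {1..j}" for i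
    using u(1)[of i "- int i"] that by blast
  moreover have "fps_nth (reduced (int i)) 0 \<noteq> 0" if "i \<in> {1..n - j}" for i
    using u(1)[of i "int i"] that by blast
  ultimately show nz: "fps_nth ?D 0 \<noteq> 0" unfolding e by simp
  have "inverse (fps_nth ?D 0) = (\<Prod>i=1..j. inverse (fps_nth (reduced (- int i)) 0))
      * (\<Prod>i=1..n - j. inverse (fps_nth (reduced (int i)) 0))"
    unfolding e inverse_mult_distrib inverse_prod ..
  also have "\<dots> \<in> S" using u(2) by (intro mult_mem prod_mem) auto
  finally have "inverse (fps_nth ?D 0) \<in> S" .
  then show "inverse ?D \<in> fps_over S"
    using nz by (intro fps_inverse_mem subring_of_axioms F.mult_mem reduced_up_mem reduced_down_mem)
qed

text \<open>The symbol is the constant term of an upward window, so the same count of multiples of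
  \<open>d\<close> applies to it.\<close>

lemma qpoch_eq: "qpoch q q m = p ^ (m div d) * fps_nth (reduced_up 0 m) 0"
proof -
  have "qpoch q q m = (\<Prod>i=1..m. 1 - q ^ i)"
    unfolding qpoch_def by (rule prod.reindex_bij_witness[of _ "\<lambda>i. i - 1" Suc]) auto
  also have "\<dots> = fps_nth (up_factors q p 0 m) 0"
    by (simp add: up_factors_def fps_prod_nth_0 q_factor_def)
  also have "\<dots> = p ^ (m div d) * fps_nth (reduced_up 0 m) 0"
    by (simp add: up_factors_eq fps_nth_power_0)
  finally show ?thesis .
qed

definition pole_core :: "nat \<Rightarrow> nat \<Rightarrow> nat \<Rightarrow> 'a fps" where
  "pole_core a r j =
     fps_const (q powi (- (int j * (int (T_exponent a r n) + 1))) * fps_nth (reduced_up 0 n) 0 ^ (2 * (a - r)))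
     * (1 + fps_const p * fps_X) ^ T_exponent a r n
     * reduced_down j (r * n) * reduced_up (n - j) (r * n)
     * inverse (reduced_down 0 j * reduced_up 0 (n - j)) ^ (2 * a)"

lemma pole_core_mem:
  assumes "j \<le> n"
  shows "pole_core a r j \<in> fps_over S"
proof -
  have "fps_nth (reduced_up 0 n) 0 \<in> S" using reduced_up_mem by (simp add: fps_over_def)
  then show ?thesis
    unfolding pole_core_def using reduced_denominator_unit(2)[OF assms]
    by (intro F.mult_mem F.power_mem F.add_mem F.one_mem fps_const_mem mult_mem power_mem q_powi_mem
        modulus_mem fps_X_mem reduced_up_mem reduced_down_mem)
qed

text \<open>The two windows, the power of \<open>(q)_n\<close> and the denominator each contribute a
  power of \<open>p\<close>; \<open>pole_order_gap\<close> is the balance, and what remains is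
  integral.\<close>

lemma pole_series_eq:
  assumes "r < a" "j \<le> n"
  shows "pole_series q p a r n j = fps_const (p ^ pole_order_gap d a r n j) * pole_core a r j"
proof -
  let ?P = "fps_const p"
  let ?z1 = "(j + r * n) div d - j div d" and ?z2 = "(n - j + r * n) div d - (n - j) div d"
  let ?L = "j div d + (n - j) div d"
  have den: "inverse (down_factors q p 0 j * up_factors q p 0 (n - j)) ^ (2 * a)
      = inverse ?P ^ (2 * a * ?L) * inverse (reduced_down 0 j * reduced_up 0 (n - j)) ^ (2 * a)"
  proof -
    have "down_factors q p 0 j * up_factors q p 0 (n - j) = ?P ^ ?L * (reduced_down 0 j * reduced_up 0 (n - j))"
      by (simp add: down_factors_eq up_factors_eq power_add mult_ac)
    then show ?thesis
      by (simp only: fps_inverse_mult power_mult_distrib fps_inverse_power power_mult[symmetric] mult.commute[of ?L])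
  qed
  have qp: "qpoch q q n ^ (2 * (a - r))
      = p ^ (2 * (a - r) * (n div d)) * fps_nth (reduced_up 0 n) 0 ^ (2 * (a - r))"
    by (simp only: qpoch_eq power_mult_distrib power_mult[symmetric] mult.commute[of "n div d"])
  have "?P ^ (2 * (a - r) * (n div d)) * ?P ^ ?z1 * ?P ^ ?z2 * inverse ?P ^ (2 * a * ?L)
      = ?P ^ pole_order_gap d a r n j * (?P ^ (2 * a * ?L) * inverse ?P ^ (2 * a * ?L))"
    unfolding power_add[symmetric] mult.assoc[symmetric] pole_order_gap_add[OF assms] ..
  also have "?P ^ (2 * a * ?L) * inverse ?P ^ (2 * a * ?L) = 1"
  proof -
    have "?P * inverse ?P = 1" using p_nonzero by (simp add: inverse_mult_eq_1')
    then show ?thesis by (simp only: power_mult_distrib[symmetric] power_one)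
  qed
  finally have P: "?P ^ (2 * (a - r) * (n div d)) * ?P ^ ?z1 * ?P ^ ?z2 * inverse ?P ^ (2 * a * ?L)
      = fps_const (p ^ pole_order_gap d a r n j)"
    by (simp add: fps_const_power)
  have "pole_series q p a r n j
      = (?P ^ (2 * (a - r) * (n div d)) * ?P ^ ?z1 * ?P ^ ?z2 * inverse ?P ^ (2 * a * ?L)) * pole_core a r j"
    unfolding pole_series_def pole_core_def den qp up_factors_eq[of "n - j"] down_factors_eq[of j]
    by (simp only: fps_const_mult[symmetric] fps_const_power[symmetric] mult_ac)
  then show ?thesis unfolding P .
qed

lemma pole_series_mem:
  assumes "r < a" "j \<le> n"
  shows "fps_nth (pole_series q p a r n j) k \<in> S"
  using pole_core_mem[OF assms(2), of a r] modulus_mem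
  by (auto simp: pole_series_eq[OF assms] fps_over_def intro: mult_mem power_mem)

end

section \<open>The classical counterpart of the expansions\<close>

definition linear_up :: "nat \<Rightarrow> nat \<Rightarrow> 'a :: field_char_0 fps" where
  "linear_up l m = (\<Prod>i\<in>{l<..m}. fps_const (of_nat i) - fps_X)"

definition linear_down :: "nat \<Rightarrow> nat \<Rightarrow> 'a :: field_char_0 fps" where
  "linear_down l m = (\<Prod>i\<in>{l<..m}. fps_const (- of_nat i) - fps_X)"

text \<open>With \<open>N = l + m\<close> and ordinary Pochhammer symbols, this is
  \<open>X^(2 a)\<close> times the expansion at \<open>t = - l - X\<close> of
  \<open>(t - z)_z (t + N + 1)_z / (t (t + 1) ... (t + N))^(2 a)\<close>.\<close>

definition classical_core :: "nat \<Rightarrow> nat \<Rightarrow> nat \<Rightarrow> nat \<Rightarrow> 'a :: field_char_0 fps" where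
  "classical_core a z l m = linear_down l (l + z) * linear_up m (m + z)
     * inverse (linear_down 0 l * linear_up 0 m) ^ (2 * a)"

lemma linear_unit: "fps_nth (linear_down 0 l * linear_up 0 m :: 'a :: field_char_0 fps) 0 \<noteq> 0"
  by (auto simp: linear_down_def linear_up_def fps_prod_nth_0)

text \<open>The reflection \<open>t -> - N - t\<close> amounts to exchanging \<open>l\<close> with
  \<open>m\<close> and \<open>X\<close> with \<open>- X\<close>. The signs cancel because both
  windows have length \<open>z\<close> and the denominator has an even exponent.\<close>

lemma classical_core_swap:
  "fps_nth (classical_core a z m l :: 'a :: field_char_0 fps) k
    = (- 1) ^ k * fps_nth (classical_core a z l m) k"
proof -
  let ?c = "\<lambda>F :: 'a fps. F oo - fps_X"
  have mult: "?c (F * G) = ?c F * ?c G" for F G by (rule fps_compose_mult_distrib) simp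
  have pow: "?c (F ^ e) = ?c F ^ e" for F e by (rule fps_compose_power[symmetric]) simp
  have up: "?c (linear_up x y) = (- 1) ^ (y - x) * linear_down x y" for x y
  proof -
    have "?c (linear_up x y) = (\<Prod>i\<in>{x<..y}. (- 1) * (fps_const (- of_nat i) - fps_X))"
      unfolding linear_up_def
      by (subst fps_compose_prod_distrib) (auto intro!: prod.cong simp: fps_compose_sub_distrib
          simp flip: fps_const_neg)
    then show ?thesis by (simp only: prod.distrib linear_down_def prod_constant card_greaterThanAtMost)
  qed
  have down: "?c (linear_down x y) = (- 1) ^ (y - x) * linear_up x y" for x y
  proof -
    have "?c (linear_down x y) = (\<Prod>i\<in>{x<..y}. (- 1) * (fps_const (of_nat i) - fps_X))"
      unfolding linear_down_def
      by (subst fps_compose_prod_distrib) (auto intro!: prod.cong simp: fps_compose_sub_distrib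
          fps_compose_uminus simp flip: fps_const_neg)
    then show ?thesis by (simp only: prod.distrib linear_up_def prod_constant card_greaterThanAtMost)
  qed
  have inv: "?c (inverse (linear_down 0 l * linear_up 0 m)) = inverse (?c (linear_down 0 l * linear_up 0 m))"
    using linear_unit by (intro fps_inverse_compose) auto
  have sq: "(- 1 :: 'a fps) ^ e * (- 1) ^ e = 1" for e
    by (simp flip: power_mult_distrib)
  have den: "inverse (?c (linear_down 0 l * linear_up 0 m)) ^ (2 * a)
      = inverse (linear_down 0 m * linear_up 0 l :: 'a fps) ^ (2 * a)"
  proof -
    have "?c (linear_down 0 l * linear_up 0 m) = (- 1) ^ (l + m) * (linear_down 0 m * linear_up 0 l)"
      by (simp add: mult up down power_add mult_ac)
    then have "?c (linear_down 0 l * linear_up 0 m) ^ 2 = (linear_down 0 m * linear_up 0 l) ^ 2"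
      by (simp add: power_mult_distrib power2_eq_square[of "(- 1) ^ (l + m)"] sq)
    then show ?thesis
      by (simp only: power_mult fps_inverse_power[symmetric])
  qed
  have den': "?c (inverse (linear_down 0 l * linear_up 0 m) ^ (2 * a))
      = inverse (linear_down 0 m * linear_up 0 l) ^ (2 * a)"
    unfolding pow inv by (rule den)
  have "?c (classical_core a z l m)
      = ((- 1) ^ z * (- 1) ^ z) * (linear_down m (m + z) * linear_up l (l + z)
        * inverse (linear_down 0 m * linear_up 0 l) ^ (2 * a))"
    unfolding classical_core_def mult den' up down add_diff_cancel_left' by (simp only: mult_ac)
  then have "?c (classical_core a z l m) = classical_core a z m l"
    by (simp only: sq mult_1_left classical_core_def)
  then show ?thesis by (metis fps_compose_uminus' fps_nth_Abs_fps)
qed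

section \<open>Reduction modulo 1 - q^d\<close>

locale local_root = local_data S p q d n
  for S :: "'a :: field_char_0 set" and p q :: 'a and d n :: nat +
  assumes p_eq: "p = 1 - q ^ d"
    and nat_unit: "\<And>m :: nat. m > 0 \<Longrightarrow> inverse (of_nat m) \<in> S"
begin

lemma cong_q_powi:
  assumes "int d dvd k - l"
  shows "cong_mod (q powi k) (q powi l)"
proof (rule cong_modI)
  have "q powi k = q powi l * q powi (k - l)" by (simp flip: q_powi_add)
  moreover have "p * (- (q powi l * ((1 - q powi (k - l)) / p))) = - (q powi l * (1 - q powi (k - l)))"
    using p_nonzero by simp
  ultimately show "q powi k = q powi l + p * (- (q powi l * ((1 - q powi (k - l)) / p)))"
    by (simp only: right_diff_distrib mult_1_right minus_diff_eq add_diff_cancel_left' add_diff_eq)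
  show "- (q powi l * ((1 - q powi (k - l)) / p)) \<in> S"
    using assms by (intro uminus_mem mult_mem q_powi_mem multiple_mem)
qed (rule q_powi_mem)

lemma cong_q_powi_1: "int d dvd k \<Longrightarrow> cong_mod (q powi k) 1"
  using cong_q_powi[of k 0] by simp

text \<open>The quotient is a geometric sum of \<open>m div d\<close> terms, each congruent to
  1.\<close>

lemma cong_multiple:
  assumes "d dvd m"
  shows "cong_mod ((1 - q powi (int m)) / p) (of_nat (m div d))"
    and "cong_mod ((1 - q powi (- int m)) / p) (- of_nat (m div d))"
proof -
  have "(1 - q powi (int m)) / p = (1 - (q ^ d) ^ (m div d)) / p"
    using assms by (simp flip: power_mult)
  also have "\<dots> = (\<Sum>i<m div d. (q ^ d) ^ i)"
    using p_nonzero by (simp add: one_diff_power_eq p_eq)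
  also have "\<dots> = (\<Sum>i<m div d. q powi (int (d * i)))"
    by (simp only: power_int_of_nat power_mult)
  finally have e: "(1 - q powi (int m)) / p = (\<Sum>i<m div d. q powi (int (d * i)))" .
  have "cong_mod (\<Sum>i<m div d. q powi (int (d * i))) (\<Sum>i<m div d. 1)"
    by (intro cong_mod_sum cong_q_powi_1) simp
  then show 1: "cong_mod ((1 - q powi (int m)) / p) (of_nat (m div d))" by (simp only: e sum_constant) simp
  have "cong_mod (q powi (- int m)) 1" using assms by (intro cong_q_powi_1) simp
  from cong_mod_uminus[OF cong_mod_mult[OF this 1]]
  show "cong_mod ((1 - q powi (- int m)) / p) (- of_nat (m div d))"
    by (simp add: one_minus_q_powi_uminus)
qed

lemma cong_fps_const: "cong_mod x y \<Longrightarrow> F.cong_mod (fps_const x) (fps_const y)"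
proof -
  assume "cong_mod x y"
  then obtain z where "y \<in> S" "z \<in> S" "x = y + p * z" by (auto simp: cong_mod_def)
  then show ?thesis
    by (intro F.cong_modI[of _ "fps_const z"]) (auto intro: fps_const_mem)
qed

definition unit_part :: "int \<Rightarrow> 'a" where
  "unit_part k = (if int d dvd k then 1 else 1 - q powi k)"

lemma unit_part_cong:
  assumes "int d dvd k - l"
  shows "cong_mod (unit_part k) (unit_part l)"
proof -
  have "int d dvd k \<longleftrightarrow> int d dvd l" using assms by (metis dvd_diff_right_iff dvd_diff_left_iff)
  then show ?thesis
    using cong_mod_diff[OF cong_mod_refl[OF one_mem] cong_q_powi[OF assms]]
    by (simp add: unit_part_def cong_mod_refl one_mem)
qed

lemma unit_part_unit:
  assumes "\<bar>k\<bar> \<le> int n"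
  shows "unit_part k \<noteq> 0" "inverse (unit_part k) \<in> S"
proof -
  show "unit_part k \<noteq> 0" using q_powi_neq_1[of k] by (auto simp: unit_part_def)
  have "inverse (1 - q powi k) \<in> S" if "\<not> int d dvd k"
  proof -
    have "k \<noteq> 0" using that by auto
    then consider "k = int (nat \<bar>k\<bar>)" "1 \<le> nat \<bar>k\<bar>" | "k = - int (nat \<bar>k\<bar>)" "1 \<le> nat \<bar>k\<bar>" by linarith
    moreover have "\<not> d dvd nat \<bar>k\<bar>" using that by (simp add: int_dvd_int_iff[symmetric])
    moreover have "nat \<bar>k\<bar> \<le> n" using assms by simp
    ultimately show ?thesis using inverse_one_minus_mem[of "nat \<bar>k\<bar>"] by cases metis+
  qed
  then show "inverse (unit_part k) \<in> S" by (auto simp: unit_part_def one_mem)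
qed

text \<open>At multiples of \<open>d\<close> a classical linear factor remains. Elsewhere the
  coefficient of \<open>X\<close> carries a factor \<open>p\<close>, so only a constant
  survives.\<close>

lemma reduced_cong:
  "F.cong_mod (reduced (int m))
     (fps_const (unit_part (int m)) * (if d dvd m then fps_const (of_nat (m div d)) - fps_X else 1))"
  "F.cong_mod (reduced (- int m))
     (fps_const (unit_part (- int m)) * (if d dvd m then fps_const (- of_nat (m div d)) - fps_X else 1))"
proof -
  have lin: "F.cong_mod (reduced k) (fps_const c - fps_X)"
    if "int d dvd k" "cong_mod ((1 - q powi k) / p) c" for k c
  proof -
    have "F.cong_mod (fps_const ((1 - q powi k) / p) - fps_const (q powi k) * fps_X) (fps_const c - 1 * fps_X)"
      using that cong_fps_const[OF cong_q_powi_1[OF that(1)]]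
      by (intro F.cong_mod_diff F.cong_mod_mult cong_fps_const F.cong_mod_refl fps_X_mem) auto
    then show ?thesis using that by (simp add: reduced_def)
  qed
  have const: "F.cong_mod (reduced k) (fps_const (1 - q powi k))" if "\<not> int d dvd k" for k
  proof (rule F.cong_modI)
    show "reduced k = fps_const (1 - q powi k) + fps_const p * (- (fps_const (q powi k) * fps_X))"
      using that by (simp add: reduced_def q_factor_def algebra_simps flip: fps_const_sub)
  qed (intro fps_const_mem diff_mem one_mem q_powi_mem F.uminus_mem F.mult_mem fps_X_mem)+
  show "F.cong_mod (reduced (int m))
     (fps_const (unit_part (int m)) * (if d dvd m then fps_const (of_nat (m div d)) - fps_X else 1))"
    using lin[OF _ cong_multiple(1), of m] const[of "int m"] by (auto simp: unit_part_def)
  show "F.cong_mod (reduced (- int m))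
     (fps_const (unit_part (- int m)) * (if d dvd m then fps_const (- of_nat (m div d)) - fps_X else 1))"
    using lin[OF _ cong_multiple(2), of m] const[of "- int m"] by (auto simp: unit_part_def)
qed

definition units_up :: "nat \<Rightarrow> nat \<Rightarrow> 'a" where
  "units_up u v = (\<Prod>i=1..v. unit_part (int (u + i)))"

definition units_down :: "nat \<Rightarrow> nat \<Rightarrow> 'a" where
  "units_down u v = (\<Prod>i=1..v. unit_part (- int (u + i)))"

lemma reduced_up_cong:
  "F.cong_mod (reduced_up u v) (fps_const (units_up u v) * linear_up (u div d) ((u + v) div d))"
  unfolding reduced_up_def units_up_def linear_up_def fps_const_prod
    prod_multiples[OF d_pos, symmetric] prod.distrib[symmetric]
  by (intro F.cong_mod_prod reduced_cong)

lemma reduced_down_cong: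
  "F.cong_mod (reduced_down u v) (fps_const (units_down u v) * linear_down (u div d) ((u + v) div d))"
  unfolding reduced_down_def units_down_def linear_down_def fps_const_prod
    prod_multiples[OF d_pos, symmetric] prod.distrib[symmetric]
  by (intro F.cong_mod_prod reduced_cong)

lemma units_cong:
  assumes "u mod d = u' mod d"
  shows "cong_mod (units_up u v) (units_up u' v)" "cong_mod (units_down u v) (units_down u' v)"
proof -
  have "int d dvd int u - int u'" using assms by (metis mod_eq_dvd_iff zmod_int)
  then have "int d dvd int (u + i) - int (u' + i)" "int d dvd - int (u + i) - (- int (u' + i))" for i
    by (simp_all add: dvd_diff_commute)
  then show "cong_mod (units_up u v) (units_up u' v)" "cong_mod (units_down u v) (units_down u' v)"
    unfolding units_up_def units_down_def by (intro cong_mod_prod unit_part_cong; blast)+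
qed

text \<open>The missing index \<open>i = j\<close> can be filled in since
  \<open>unit_part 0 = 1\<close>. In this form the product visibly depends, up to congruence, only
  on \<open>j\<close> modulo \<open>d\<close>.\<close>

lemma units_denominator:
  assumes "j \<le> n"
  shows "units_down 0 j * units_up 0 (n - j) = (\<Prod>i\<in>{0..n}. unit_part (int i - int j))"
proof -
  have "(\<Prod>i\<in>{0..n}. unit_part (int i - int j)) = (\<Prod>i\<in>{0..n} - {j}. unit_part (int i - int j))"
    using assms by (subst prod.remove[of _ j]) (auto simp: unit_part_def)
  then show ?thesis
    using prod_split_at[OF assms, of unit_part] by (simp add: units_down_def units_up_def)
qed

lemma units_denominator_unit:
  assumes "j \<le> n"
  shows "units_down 0 j * units_up 0 (n - j) \<noteq> 0" "inverse (units_down 0 j * units_up 0 (n - j)) \<in> S"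
  unfolding units_denominator[OF assms] inverse_prod
  using unit_part_unit assms by (auto intro!: prod_mem)

lemma linear_mem: "linear_up l m \<in> fps_over S" "linear_down l m \<in> fps_over S"
  unfolding linear_up_def linear_down_def
  by (auto intro!: F.prod_mem F.diff_mem fps_const_mem fps_X_mem of_nat_mem uminus_mem
      simp del: fps_const_neg)

lemma inverse_linear_mem: "inverse (linear_down 0 l * linear_up 0 m) \<in> fps_over S"
proof (rule fps_inverse_mem[OF subring_of_axioms _ linear_unit])
  have "inverse (fps_nth (linear_down 0 l * linear_up 0 m :: 'a fps) 0)
      = (\<Prod>i\<in>{0<..l}. - inverse (of_nat i)) * (\<Prod>i\<in>{0<..m}. inverse (of_nat i))"
    by (simp add: linear_down_def linear_up_def fps_prod_nth_0 inverse_prod)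
  also have "\<dots> \<in> S" by (intro mult_mem prod_mem uminus_mem nat_unit) auto
  finally show "inverse (fps_nth (linear_down 0 l * linear_up 0 m :: 'a fps) 0) \<in> S" .
qed (intro F.mult_mem linear_mem)

lemma classical_core_mem: "classical_core a z l m \<in> fps_over S"
  unfolding classical_core_def by (intro F.mult_mem F.power_mem linear_mem inverse_linear_mem)

definition class_const :: "nat \<Rightarrow> nat \<Rightarrow> nat \<Rightarrow> 'a" where
  "class_const a r j = q powi (- (int j * (int (T_exponent a r n) + 1)))
     * fps_nth (reduced_up 0 n) 0 ^ (2 * (a - r)) * units_down j (r * n) * units_up (n - j) (r * n)
     * inverse (units_down 0 j * units_up 0 (n - j)) ^ (2 * a)"

lemma reduced_up_0_mem: "fps_nth (reduced_up u v) k \<in> S"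
  using reduced_up_mem by (simp add: fps_over_def)

text \<open>A vanishing gap means that each numerator window contains exactly
  \<open>r (n div d)\<close> multiples of \<open>d\<close>; the classical part then depends on
  \<open>j\<close> only through the two quotients.\<close>

lemma pole_core_cong:
  assumes "r < a" "j \<le> n" "pole_order_gap d a r n j = 0"
  shows "F.cong_mod (pole_core a r j)
    (fps_const (class_const a r j) * classical_core a (r * (n div d)) (j div d) ((n - j) div d))"
proof -
  let ?l = "j div d" and ?m = "(n - j) div d" and ?z = "r * (n div d)"
  let ?u = "units_down 0 j * units_up 0 (n - j)"
  let ?c = "q powi (- (int j * (int (T_exponent a r n) + 1))) * fps_nth (reduced_up 0 n) 0 ^ (2 * (a - r))"
  note gap = pole_order_gap_0[OF assms]
  have 1: "F.cong_mod (1 + fps_const p * fps_X) 1"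
    by (rule F.cong_modI[of _ fps_X]) (auto intro: F.one_mem fps_X_mem)
  have 2: "F.cong_mod (reduced_down j (r * n)) (fps_const (units_down j (r * n)) * linear_down ?l (?l + ?z))"
    using reduced_down_cong[of j "r * n"] gap by simp
  have 3: "F.cong_mod (reduced_up (n - j) (r * n)) (fps_const (units_up (n - j) (r * n)) * linear_up ?m (?m + ?z))"
    using reduced_up_cong[of "n - j" "r * n"] gap by simp
  have 4: "F.cong_mod (inverse (reduced_down 0 j * reduced_up 0 (n - j)))
      (fps_const (inverse ?u) * inverse (linear_down 0 ?l * linear_up 0 ?m))"
  proof (rule F.cong_mod_inverse)
    show "F.cong_mod (reduced_down 0 j * reduced_up 0 (n - j))
        ((fps_const (units_down 0 j) * linear_down 0 ?l) * (fps_const (units_up 0 (n - j)) * linear_up 0 ?m))"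
      using reduced_down_cong[of 0 j] reduced_up_cong[of 0 "n - j"] by (intro F.cong_mod_mult) simp_all
    show "reduced_down 0 j * reduced_up 0 (n - j) * inverse (reduced_down 0 j * reduced_up 0 (n - j)) = 1"
      using reduced_denominator_unit(1)[OF assms(2)] by (rule inverse_mult_eq_1')
    have "(linear_down 0 ?l * linear_up 0 ?m) * inverse (linear_down 0 ?l * linear_up 0 ?m :: 'a fps) = 1"
      by (rule inverse_mult_eq_1'[OF linear_unit])
    moreover have "fps_const (units_down 0 j) * fps_const (units_up 0 (n - j)) * fps_const (inverse ?u) = 1"
      by (simp only: fps_const_mult right_inverse[OF units_denominator_unit(1)[OF assms(2)]] fps_const_1_eq_1)
    ultimately have "(fps_const (units_down 0 j) * fps_const (units_up 0 (n - j)) * fps_const (inverse ?u))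
        * ((linear_down 0 ?l * linear_up 0 ?m) * inverse (linear_down 0 ?l * linear_up 0 ?m :: 'a fps)) = 1"
      by (simp only: mult_1_left)
    then show "fps_const (units_down 0 j) * linear_down 0 ?l * (fps_const (units_up 0 (n - j)) * linear_up 0 ?m)
        * (fps_const (inverse ?u) * inverse (linear_down 0 ?l * linear_up 0 ?m)) = 1"
      by (simp only: mult_ac)
    show "fps_const (inverse ?u) * inverse (linear_down 0 ?l * linear_up 0 ?m) \<in> fps_over S"
      by (intro F.mult_mem fps_const_mem inverse_linear_mem units_denominator_unit assms)
  qed (rule reduced_denominator_unit(2)[OF assms(2)])
  have c: "?c \<in> S" by (intro mult_mem power_mem q_powi_mem reduced_up_0_mem)
  have "F.cong_mod (pole_core a r j) (fps_const ?c * 1 ^ T_exponent a r n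
      * (fps_const (units_down j (r * n)) * linear_down ?l (?l + ?z))
      * (fps_const (units_up (n - j) (r * n)) * linear_up ?m (?m + ?z))
      * (fps_const (inverse ?u) * inverse (linear_down 0 ?l * linear_up 0 ?m)) ^ (2 * a))"
    unfolding pole_core_def
    by (intro F.cong_mod_mult F.cong_mod_power 1 2 3 4 F.cong_mod_refl fps_const_mem c)
  also have "fps_const ?c * 1 ^ T_exponent a r n
      * (fps_const (units_down j (r * n)) * linear_down ?l (?l + ?z))
      * (fps_const (units_up (n - j) (r * n)) * linear_up ?m (?m + ?z))
      * (fps_const (inverse ?u) * inverse (linear_down 0 ?l * linear_up 0 ?m)) ^ (2 * a)
    = fps_const (class_const a r j) * classical_core a ?z ?l ?m"
    unfolding class_const_def classical_core_def fps_const_mult[symmetric]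
      fps_const_power[symmetric] power_mult_distrib power_one
    by (simp only: mult_ac mult_1_left)
  finally show ?thesis .
qed

text \<open>Modulo \<open>p\<close> every ingredient depends on \<open>j\<close> and
  \<open>n - j\<close> only through their remainders modulo \<open>d\<close>, and these are kept by
  the reflection.\<close>

lemma class_const_cong:
  assumes "j \<le> n"
  shows "cong_mod (class_const a r (class_reflect d n j)) (class_const a r j)"
proof -
  let ?j = "class_reflect d n j"
  note cr = class_reflect[OF d_pos assms]
  have dv: "int d dvd int ?j - int j" using cr(2) by (metis mod_eq_dvd_iff zmod_int)
  let ?M = "int (T_exponent a r n) + 1"
  have "int d dvd - (int ?j * ?M) - - (int j * ?M)"
  proof -
    have "- (int ?j * ?M) - - (int j * ?M) = - ((int ?j - int j) * ?M)" by (simp add: algebra_simps)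
    then show ?thesis using dv by (simp only: dvd_minus_iff dvd_mult2)
  qed
  note 1 = cong_q_powi[OF this]
  have "int d dvd (int i - int ?j) - (int i - int j)" for i
    using dv by (simp add: dvd_diff_commute)
  then have "cong_mod (units_down 0 ?j * units_up 0 (n - ?j)) (units_down 0 j * units_up 0 (n - j))"
    unfolding units_denominator[OF assms] units_denominator[OF cr(1)]
    by (intro cong_mod_prod unit_part_cong)
  then have 2: "cong_mod (inverse (units_down 0 ?j * units_up 0 (n - ?j)))
      (inverse (units_down 0 j * units_up 0 (n - j)))"
    by (rule cong_mod_inverse[OF _ right_inverse right_inverse])
       (intro units_denominator_unit assms cr)+
  show ?thesis unfolding class_const_def
    by (intro cong_mod_mult cong_mod_power 1 2 units_cong cr cong_mod_refl power_mem reduced_up_0_mem)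
qed

text \<open>If the gap is positive, both sides vanish modulo \<open>p\<close>, since the gap is
  invariant. Otherwise the constants agree, and exchanging the quotients is the reflection of the
  classical core.\<close>

lemma pole_series_class_reflect:
  assumes "r < a" "j \<le> n"
  shows "cong_mod (fps_nth (pole_series q p a r n (class_reflect d n j)) k)
    ((- 1) ^ k * fps_nth (pole_series q p a r n j) k)"
proof (cases "pole_order_gap d a r n j = 0")
  case False
  have z: "cong_mod (fps_nth (pole_series q p a r n i) k) 0"
    if "i \<le> n" "pole_order_gap d a r n i = pole_order_gap d a r n j" for i
  proof -
    obtain e where e: "pole_order_gap d a r n j = Suc e" using False not0_implies_Suc by blast
    have "fps_nth (pole_series q p a r n i) k = p * (p ^ e * fps_nth (pole_core a r i) k)"
      using that e by (simp add: pole_series_eq[OF assms(1)])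
    moreover have "p ^ e * fps_nth (pole_core a r i) k \<in> S"
      using pole_core_mem[OF that(1), of a r] modulus_mem
      by (auto simp: fps_over_def intro: mult_mem power_mem)
    ultimately show ?thesis by (simp add: cong_mod_zeroI)
  qed
  have "cong_mod (fps_nth (pole_series q p a r n (class_reflect d n j)) k) 0"
    using assms d_pos by (intro z class_reflect_le pole_order_gap_class_reflect)
  moreover have "cong_mod ((- 1) ^ k * fps_nth (pole_series q p a r n j) k) ((- 1) ^ k * 0)"
    using assms by (intro cong_mod_mult z cong_mod_refl minus_one_power_mem) auto
  ultimately show ?thesis by (metis cong_mod_sym cong_mod_trans mult_zero_right)
next
  case True
  let ?j = "class_reflect d n j"
  let ?z = "r * (n div d)" and ?l = "j div d" and ?m = "(n - j) div d"
  note cr = class_reflect[OF d_pos assms(2)]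
  have True': "pole_order_gap d a r n ?j = 0"
    using True pole_order_gap_class_reflect[OF d_pos assms(2)] by simp
  have mem: "fps_nth (classical_core a ?z ?m ?l) k \<in> S"
    using classical_core_mem by (simp add: fps_over_def)
  have "cong_mod (fps_nth (pole_series q p a r n ?j) k)
      (class_const a r ?j * fps_nth (classical_core a ?z ?m ?l) k)"
    using cong_mod_fps_nth[OF pole_core_cong[OF assms(1) cr(1) True'], of k] True' cr
    by (simp add: pole_series_eq[OF assms(1)])
  moreover have "cong_mod (class_const a r ?j * fps_nth (classical_core a ?z ?m ?l) k)
      (class_const a r j * fps_nth (classical_core a ?z ?m ?l) k)"
    by (intro cong_mod_mult class_const_cong assms cong_mod_refl mem)
  moreover have "class_const a r j * fps_nth (classical_core a ?z ?m ?l) k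
      = (- 1) ^ k * (class_const a r j * fps_nth (classical_core a ?z ?l ?m) k)"
    by (subst classical_core_swap) (simp only: mult_ac)
  moreover have "cong_mod ((- 1) ^ k * fps_nth (pole_series q p a r n j) k)
      ((- 1) ^ k * (class_const a r j * fps_nth (classical_core a ?z ?l ?m) k))"
    using cong_mod_fps_nth[OF pole_core_cong[OF assms True], of k] True
    by (intro cong_mod_mult cong_mod_refl minus_one_power_mem) (simp add: pole_series_eq[OF assms])
  ultimately show ?thesis by (metis cong_mod_sym cong_mod_trans)
qed

end

subsection \<open>Integrality of \<open>P0_hat\<close> at the finite places\<close>

lemma scaled_P0_weight:
  fixes p :: ratfun
  shows "p ^ s * P0_weight n s j = (\<Sum>k=1..j. (-1) ^ s * (qq ^ k * (p / (1 - qq ^ k)) ^ s))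
     - (\<Sum>k=1..n - j. qq ^ (k * (s - 1)) * (p / (1 - qq ^ k)) ^ s)"
  by (simp add: P0_weight_def right_diff_distrib sum_distrib_left power_divide mult_ac)

text \<open>In \<open>p^(2 a) = p^(2 a - s) p^s\<close> the first power clears the coefficient and
  the second the weight, whose denominators are \<open>(1 - q^k)^s\<close>. The derivative part has
  integer weights and so keeps a spare factor \<open>p\<close>.\<close>

lemma scaled_P0_hat:
  fixes p :: ratfun
  assumes "0 < r" "r < a"
  shows "p ^ (2 * a) * P0_hat (2 * a) r n
    = (\<Sum>j=0..n. \<Sum>s=1..2 * a. fps_nth (pole_series qq p a r n j) (2 * a - s) * (p ^ s * P0_weight n s j))
      + p * (\<Sum>j=0..n. of_nat j * fps_nth (pole_series qq p a r n j) (2 * a - 1))"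
proof -
  have 1: "p ^ (2 * a) * (b_coeff a r n s j * P0_weight n s j)
      = fps_nth (pole_series qq p a r n j) (2 * a - s) * (p ^ s * P0_weight n s j)"
    if "s \<in> {1..2 * a}" "j \<in> {0..n}" for s j
  proof -
    have "p ^ (2 * a) = p ^ (2 * a - s) * p ^ s" using that by (simp flip: power_add)
    then show ?thesis
      using b_coeff_eq[OF assms, of j n s p, symmetric] that by (simp only: mult_ac) auto
  qed
  have 2: "p ^ (2 * a) * (of_nat j * b_coeff a r n 1 j)
      = p * (of_nat j * fps_nth (pole_series qq p a r n j) (2 * a - 1))"
    if "j \<in> {0..n}" for j
  proof -
    have "p ^ (2 * a) = p * p ^ (2 * a - 1)" using assms by (simp flip: power_Suc)
    moreover have "fps_nth (pole_series qq p a r n j) (2 * a - 1) = p ^ (2 * a - 1) * b_coeff a r n 1 j"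
      using b_coeff_eq[OF assms, of j n 1 p] that assms by simp
    ultimately show ?thesis by (simp only: mult_ac)
  qed
  have "p ^ (2 * a) * (\<Sum>s=1..2 * a. \<Sum>j=0..n. b_coeff a r n s j * P0_weight n s j)
      = (\<Sum>s=1..2 * a. \<Sum>j=0..n. fps_nth (pole_series qq p a r n j) (2 * a - s) * (p ^ s * P0_weight n s j))"
    unfolding sum_distrib_left by (intro sum.cong refl 1)
  moreover have "p ^ (2 * a) * (\<Sum>j=0..n. of_nat j * b_coeff a r n 1 j)
      = p * (\<Sum>j=0..n. of_nat j * fps_nth (pole_series qq p a r n j) (2 * a - 1))"
    unfolding sum_distrib_left by (intro sum.cong refl 2)
  ultimately show ?thesis
    unfolding P0_hat_eq[OF assms] distrib_left by (subst sum.swap) simp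
qed

lemma scaled_P0_weight_mem:
  assumes "local_data S p qq d n" "j \<le> n"
  shows "p ^ s * P0_weight n s j \<in> S"
proof -
  interpret local_data S p qq d n by fact
  show ?thesis unfolding scaled_P0_weight using assms(2)
    by (intro diff_mem sum_mem mult_mem power_mem minus_one_power_mem q_mem p_div_one_minus_mem') auto
qed

lemma P0_hat_local_data:
  assumes "local_data S p qq d n" "0 < r" "r < a"
  shows "p ^ (2 * a) * P0_hat (2 * a) r n \<in> S"
proof -
  interpret local_data S p qq d n by fact
  have "fps_nth (pole_series qq p a r n j) k \<in> S" if "j \<in> {0..n}" for j k
    using pole_series_mem[OF assms(3)] that by simp
  moreover have "p ^ s * P0_weight n s j \<in> S" if "j \<in> {0..n}" for j s
    using scaled_P0_weight_mem[OF assms(1)] that by simp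
  ultimately show ?thesis unfolding scaled_P0_hat[OF assms(2,3)]
    by (intro add_mem mult_mem[of p] sum_mem mult_mem[of "of_nat _"] mult_mem[of "fps_nth _ _"]
        modulus_mem of_nat_mem)
qed

text \<open>Modulo \<open>1 - q\<^sup>d\<close> the summand of index \<open>j\<close> and the one of the reflected index cancel.\<close>

lemma P0_hat_local_root:
  assumes "local_root S p qq d n" "0 < r" "r < a"
  shows "p ^ (2 * a - 1) * P0_hat (2 * a) r n \<in> S"
proof -
  interpret local_root S p qq d n by fact
  define V where "V j s = fps_nth (pole_series qq p a r n j) (2 * a - s)" for j s
  define W where "W j s = p ^ s * P0_weight n s j" for j s
  define h where "h s N = (\<Sum>l\<in>{0<..N}. inverse (of_nat l) ^ s :: ratfun)" for s N :: nat
  define Z where "Z = (\<Sum>j=0..n. \<Sum>s=1..2 * a. V j s * W j s)"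
  let ?f = "class_reflect d n"
  \<comment> \<open>Off the multiples of \<open>d\<close> the denominator is a unit, so
    \<open>p^s\<close> with \<open>s \<ge> 1\<close> kills the summand. What survives are the terms
    of the harmonic sum \<open>h s\<close>; the exponents \<open>k\<close> and
    \<open>k (s - 1)\<close> of \<open>q\<close> are both covered by \<open>e\<close>.\<close>
  have summand: "cong_mod (qq ^ e * (p / (1 - qq ^ k)) ^ s)
      (if d dvd k then inverse (of_nat (k div d)) ^ s else 0)"
    if "s \<ge> 1" "1 \<le> k" "k \<le> n" "d dvd k \<longrightarrow> d dvd e" for e k s
  proof (cases "d dvd k")
    case True
    have pos: "k div d > 0" using True that d_pos dvd_imp_le[of d k] by (simp add: div_greater_zero_iff)
    have "1 - qq ^ k \<noteq> 0" using q_powi_neq_1[of "int k"] that by simp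
    then have "(1 - qq ^ k) / p * (p / (1 - qq ^ k)) = 1" using p_nonzero by simp
    moreover have "of_nat (k div d) * inverse (of_nat (k div d)) = (1 :: ratfun)"
      using pos by (intro right_inverse) simp
    moreover have "inverse (of_nat (k div d)) \<in> S"
      using pos by (rule nat_unit)
    moreover have "cong_mod ((1 - qq ^ k) / p) (of_nat (k div d))"
      using cong_multiple(1)[OF True] by simp
    ultimately have "cong_mod (p / (1 - qq ^ k)) (inverse (of_nat (k div d)))"
      using cong_mod_inverse p_div_one_minus_mem'[OF that(2,3)] by blast
    moreover have "cong_mod (qq ^ e) 1"
      using cong_q_powi_1[of "int e"] True that by simp
    ultimately have "cong_mod (qq ^ e * (p / (1 - qq ^ k)) ^ s) (1 * inverse (of_nat (k div d)) ^ s)"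
      by (intro cong_mod_mult cong_mod_power)
    then show ?thesis using True by simp
  next
    case False
    from that(1) obtain t where t: "s = Suc t" by (cases s) auto
    have "qq ^ e * (p / (1 - qq ^ k)) ^ s
        = p * (qq ^ e * inverse (1 - qq ^ k) * (p / (1 - qq ^ k)) ^ t)"
      by (simp add: t divide_inverse mult_ac)
    moreover have "qq ^ e * inverse (1 - qq ^ k) * (p / (1 - qq ^ k)) ^ t \<in> S"
      using False that by (intro mult_mem power_mem q_mem nonmultiple_unit p_div_one_minus_mem')
    ultimately have "cong_mod (qq ^ e * (p / (1 - qq ^ k)) ^ s) 0" by (simp only: cong_mod_zeroI)
    then show ?thesis using False by simp
  qed
  have W: "cong_mod (W j s) ((-1) ^ s * h s (j div d) - h s ((n - j) div d))"
    if "s \<ge> 1" "j \<le> n" for j s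
  proof -
    have "cong_mod (\<Sum>k=1..j. qq ^ k * (p / (1 - qq ^ k)) ^ s) (h s (j div d))"
      unfolding h_def sum_multiples[OF d_pos, symmetric]
      using that by (intro cong_mod_sum summand) auto
    then have "cong_mod ((-1) ^ s * (\<Sum>k=1..j. qq ^ k * (p / (1 - qq ^ k)) ^ s)) ((-1) ^ s * h s (j div d))"
      by (intro cong_mod_mult cong_mod_refl minus_one_power_mem)
    moreover have "cong_mod (\<Sum>k=1..n - j. qq ^ (k * (s - 1)) * (p / (1 - qq ^ k)) ^ s) (h s ((n - j) div d))"
      unfolding h_def sum_multiples[OF d_pos, symmetric]
      using that by (intro cong_mod_sum summand) auto
    ultimately show ?thesis
      unfolding W_def scaled_P0_weight sum_distrib_left[symmetric] by (rule cong_mod_diff)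
  qed
  have sq: "(-1 :: ratfun) ^ s * (-1) ^ s = 1" for s by (simp flip: power_mult_distrib)
  \<comment> \<open>The reflection lets the two harmonic sums trade places; the opposite sign
    between them gives the antisymmetry.\<close>
  have W_reflect: "cong_mod (W (?f j) s) (- ((-1) ^ s * W j s))" if "s \<ge> 1" "j \<le> n" for j s
  proof -
    note cr = class_reflect[OF d_pos that(2)]
    have "cong_mod (W (?f j) s) ((-1) ^ s * h s ((n - j) div d) - h s (j div d))"
      using W[OF that(1) cr(1)] cr by simp
    moreover have "cong_mod (- ((-1) ^ s * W j s))
        (- ((-1) ^ s * ((-1) ^ s * h s (j div d) - h s ((n - j) div d))))"
      by (intro cong_mod_uminus cong_mod_mult W that cong_mod_refl minus_one_power_mem)
    moreover have "- ((-1) ^ s * ((-1) ^ s * h s (j div d) - h s ((n - j) div d)))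
        = (-1) ^ s * h s ((n - j) div d) - h s (j div d)"
      by (simp add: right_diff_distrib sq flip: mult.assoc)
    ultimately show ?thesis by (metis cong_mod_sym cong_mod_trans)
  qed
  have V_reflect: "cong_mod (V (?f j) s) ((-1) ^ s * V j s)" if "s \<le> 2 * a" "j \<le> n" for j s
  proof -
    have "(-1 :: ratfun) ^ (2 * a - s) = (-1) ^ s"
      using that by (simp add: minus_one_power_iff)
    then show ?thesis using pole_series_class_reflect[OF assms(3) that(2), of "2 * a - s"]
      by (simp add: V_def)
  qed
  have Z_reflect: "Z = (\<Sum>j=0..n. \<Sum>s=1..2 * a. V (?f j) s * W (?f j) s)"
    unfolding Z_def
    by (rule sum.reindex_bij_witness[of _ ?f ?f]) (auto simp: class_reflect d_pos)
  moreover have "cong_mod (\<Sum>j=0..n. \<Sum>s=1..2 * a. V (?f j) s * W (?f j) s)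
      (\<Sum>j=0..n. \<Sum>s=1..2 * a. ((-1) ^ s * V j s) * (- ((-1) ^ s * W j s)))"
    by (intro cong_mod_sum cong_mod_mult V_reflect W_reflect) auto
  moreover have neg: "((-1) ^ s * V j s) * (- ((-1) ^ s * W j s)) = - (V j s * W j s)" for j s
  proof -
    have "((-1) ^ s * V j s) * (- ((-1) ^ s * W j s)) = - (((-1) ^ s * (-1) ^ s) * (V j s * W j s))"
      by (simp only: mult_ac mult_minus_right)
    then show ?thesis by (simp only: sq mult_1_left)
  qed
  ultimately have "cong_mod Z (- Z)"
    unfolding Z_reflect[symmetric] neg sum_negf Z_def[symmetric] by blast
  \<comment> \<open>Twice \<open>Z\<close> is a multiple of \<open>p\<close>, and 2 is a unit in
    \<open>S\<close> by \<open>nat_unit\<close>. Indices fixed by the reflection need no separate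
    treatment.\<close>
  then obtain z where z: "z \<in> S" "Z = - Z + p * z" by (auto simp: cong_mod_def)
  then have "Z = p * (inverse (of_nat 2) * z)" by simp
  moreover define Y where "Y = (\<Sum>j=0..n. of_nat j * V j 1)"
  ultimately have "p ^ (2 * a) * P0_hat (2 * a) r n = p * (inverse (of_nat 2) * z + Y)"
    unfolding scaled_P0_hat[OF assms(2,3)] Z_def[symmetric, unfolded V_def W_def] Y_def V_def
    by (simp add: distrib_left)
  moreover have "p ^ (2 * a) = p * p ^ (2 * a - 1)" using assms by (simp flip: power_Suc)
  ultimately have "p ^ (2 * a - 1) * P0_hat (2 * a) r n = inverse (of_nat 2) * z + Y"
    using p_nonzero by (simp add: mult.assoc)
  moreover have "V j s \<in> S" if "j \<le> n" for j s
    unfolding V_def using assms(3) that by (rule pole_series_mem)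
  then have "Y \<in> S" unfolding Y_def by (intro sum_mem mult_mem of_nat_mem) auto
  moreover have "inverse (of_nat 2) * z \<in> S" using z by (intro mult_mem nat_unit) auto
  ultimately show ?thesis by (simp only: add_mem)
qed

subsection \<open>The degree in \<open>q\<close>\<close>

text \<open>In the application \<open>S\<close> is the valuation ring at \<open>q = \<infinity>\<close>, so that \<open>degree_le e F\<close> bounds the degrees in
  \<open>q\<close> of all coefficients of \<open>F\<close> by \<open>e\<close>.\<close>

locale infinite_place = subring_of S for S :: "'a :: field set" +
  fixes q :: 'a
  assumes q_nonzero: "q \<noteq> 0"
    and inverse_q_mem: "inverse q \<in> S"
    and q_power_neq_1: "\<And>k :: nat. k > 0 \<Longrightarrow> q ^ k \<noteq> 1"
    and unit: "\<And>k :: nat. k > 0 \<Longrightarrow> inverse (1 - inverse q ^ k) \<in> S"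
begin

sublocale F: subring_of "fps_over S"
  by (rule subring_of_fps_over)

definition degree_le :: "int \<Rightarrow> 'a fps \<Rightarrow> bool" where
  "degree_le e F \<longleftrightarrow> fps_const (q powi (- e)) * F \<in> fps_over S"

lemma q_powi_add: "q powi (k + l) = q powi k * q powi l"
  using q_nonzero by (simp add: power_int_add)

lemma q_powi_uminus_mem: "k \<ge> 0 \<Longrightarrow> q powi (- k) \<in> S"
  using inverse_q_mem
  by (cases k) (auto simp: power_int_minus power_inverse[symmetric] intro: power_mem)

lemma degree_le_mult:
  assumes "degree_le e F" "degree_le e' G"
  shows "degree_le (e + e') (F * G)"
proof -
  have "fps_const (q powi (- (e + e'))) * (F * G)
      = (fps_const (q powi (- e)) * F) * (fps_const (q powi (- e')) * G)"
    unfolding minus_add_distrib q_powi_add fps_const_mult[symmetric] by (simp only: mult_ac)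
  then show ?thesis using assms unfolding degree_le_def by (simp only: F.mult_mem)
qed

lemma degree_le_1: "degree_le 0 1"
  using F.one_mem by (simp add: degree_le_def)

lemma degree_le_power: "degree_le e F \<Longrightarrow> degree_le (int k * e) (F ^ k)"
  by (induction k) (auto simp: degree_le_1 distrib_right intro: degree_le_mult)

lemma degree_le_prod: "(\<And>i. i \<in> I \<Longrightarrow> degree_le (e i) (f i)) \<Longrightarrow> degree_le (sum e I) (prod f I)"
  by (induction I rule: infinite_finite_induct) (auto simp: degree_le_1 intro: degree_le_mult)

lemma degree_le_q_powi: "degree_le e (fps_const (q powi e))"
proof -
  have "q powi (- e) * q powi e = 1" by (simp flip: q_powi_add)
  then show ?thesis using F.one_mem by (simp add: degree_le_def)
qed

lemma q_powi_times_nth_mem: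
  assumes "degree_le e F" "e \<le> e'"
  shows "q powi (- e') * fps_nth F k \<in> S"
proof -
  have "q powi (- e') = q powi (- (e' - e)) * q powi (- e)" by (simp flip: q_powi_add)
  moreover have "q powi (- e) * fps_nth F k \<in> S"
    using assms(1) by (auto simp: degree_le_def fps_over_def)
  ultimately show ?thesis
    using mult_mem[OF q_powi_uminus_mem[of "e' - e"]] assms(2) by (simp add: mult.assoc)
qed

text \<open>Both coefficients of an upward factor have degree \<open>m\<close> at most; after
  division by \<open>q^m\<close> its constant term is a unit at infinity, so the inverse has degree
  at most \<open>- m\<close>.\<close>

lemma up_factor_eq:
  "fps_const (q powi (- int m)) * q_factor q 1 (int m) = fps_const (inverse q ^ m - 1) - fps_X"
proof -
  have "q powi (- int m) = inverse q ^ m" by (simp add: power_int_minus power_inverse)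
  moreover have "inverse q ^ m * q ^ m = 1" using q_nonzero by (simp flip: power_mult_distrib)
  then have "fps_const (inverse q ^ m) * fps_const (q ^ m) = 1"
    by (simp add: fps_const_1_eq_1[symmetric] del: fps_const_1_eq_1)
  ultimately show ?thesis
    by (simp add: q_factor_def right_diff_distrib mult.assoc[symmetric] del: fps_const_mult flip: fps_const_sub)
qed

lemma degree_le_up_factor: "degree_le (int m) (q_factor q 1 (int m))"
  unfolding degree_le_def up_factor_eq
  by (intro F.diff_mem fps_const_mem diff_mem power_mem inverse_q_mem one_mem fps_X_mem)

lemma degree_le_down_factor: "degree_le 0 (q_factor q 1 (- int m))"
  unfolding degree_le_def q_factor_def
  by (simp, intro F.diff_mem F.mult_mem F.add_mem F.one_mem fps_const_mem q_powi_uminus_mem fps_X_mem) auto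

lemma inverse_power_neq_1: "m > 0 \<Longrightarrow> inverse q ^ m \<noteq> 1"
  using q_power_neq_1[of m] by (simp add: power_inverse)

lemma degree_le_inverse_up_factor:
  assumes "m > 0"
  shows "degree_le (- int m) (inverse (q_factor q 1 (int m)))"
proof -
  have "fps_const (q powi (- (- int m))) * inverse (q_factor q 1 (int m))
      = inverse (fps_const (inverse q ^ m - 1) - fps_X)"
    by (simp add: fps_inverse_mult fps_const_inverse power_int_minus flip: up_factor_eq)
  also have "\<dots> \<in> fps_over S"
  proof (rule fps_inverse_mem[OF subring_of_axioms])
    have "inverse (inverse q ^ m - 1) = - inverse (1 - inverse q ^ m)"
      by (simp flip: inverse_minus_eq)
    then show "inverse (fps_nth (fps_const (inverse q ^ m - 1) - fps_X) 0) \<in> S"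
      using unit[OF assms] uminus_mem by simp
    show "fps_nth (fps_const (inverse q ^ m - 1) - fps_X) 0 \<noteq> 0"
      using inverse_power_neq_1[OF assms] by simp
  qed (intro F.diff_mem fps_const_mem diff_mem power_mem inverse_q_mem one_mem fps_X_mem)
  finally show ?thesis unfolding degree_le_def .
qed

lemma degree_le_inverse_down_factor:
  assumes "m > 0"
  shows "degree_le 0 (inverse (q_factor q 1 (- int m)))"
proof -
  have "fps_nth (q_factor q 1 (- int m)) 0 = 1 - inverse q ^ m"
    by (simp add: q_factor_def power_int_minus power_inverse)
  then have "inverse (q_factor q 1 (- int m)) \<in> fps_over S"
    using degree_le_down_factor[of m] unit[OF assms] inverse_power_neq_1[OF assms]
    by (intro fps_inverse_mem[OF subring_of_axioms]) (auto simp: degree_le_def)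
  then show ?thesis by (simp add: degree_le_def)
qed

lemma fps_inverse_prod: "inverse (prod f I) = (\<Prod>i\<in>I. inverse (f i :: 'a fps))"
  by (induction I rule: infinite_finite_induct) (simp_all add: fps_inverse_mult)

text \<open>Degrees add up: an upward factor counts with its index, a downward factor with 0, and
  inverses with the opposite. Twice the total is the stated bound minus \<open>r n\<close>, which is
  discarded; doubling avoids the halves in triangular numbers.\<close>

lemma degree_le_pole_series:
  assumes "0 < r" "r < a" "j \<le> n" "2 * e \<ge> 2 * int a * int j * int (n - j) + 2 * int j + (int r * int n)\<^sup>2"
  shows "q powi (- e) * fps_nth (pole_series q 1 a r n j) k \<in> S"
proof -
  define t where "t m = (\<Sum>i=1..m. int i)" for m :: nat
  have t: "2 * t m = int m * (int m + 1)" for m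
    unfolding t_def by (induction m) (simp_all add: algebra_simps)
  let ?M = "int (T_exponent a r n)"
  have qp: "degree_le (t n) (fps_const (qpoch q q n))"
  proof -
    have "qpoch q q n = (\<Prod>i=1..n. 1 - q ^ i)"
      unfolding qpoch_def by (rule prod.reindex_bij_witness[of _ "\<lambda>i. i - 1" Suc]) auto
    moreover have "degree_le (int i) (fps_const (1 - q ^ i))" for i
    proof -
      have "q powi (- int i) * (1 - q ^ i) = inverse q ^ i - 1"
        using q_nonzero by (simp add: power_int_minus power_inverse right_diff_distrib)
      then show ?thesis unfolding degree_le_def fps_const_mult
        by (simp only:) (intro fps_const_mem diff_mem power_mem inverse_q_mem one_mem)
    qed
    ultimately show ?thesis unfolding t_def by (simp only: fps_const_prod degree_le_prod)
  qed
  have X: "degree_le 0 (1 + fps_const 1 * fps_X)"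
    unfolding degree_le_def by (simp, intro F.add_mem F.one_mem fps_X_mem)
  have up: "degree_le (\<Sum>i=1..v. int (u + i)) (up_factors q 1 u v)" for u v
    unfolding up_factors_def by (intro degree_le_prod degree_le_up_factor)
  have down: "degree_le (\<Sum>i=1..v. 0) (down_factors q 1 u v)" for u v
    unfolding down_factors_def by (intro degree_le_prod degree_le_down_factor)
  have iup: "degree_le (\<Sum>i=1..v. - int (0 + i)) (inverse (up_factors q 1 0 v))" for v
    unfolding up_factors_def fps_inverse_prod by (intro degree_le_prod degree_le_inverse_up_factor) auto
  have idown: "degree_le (\<Sum>i=1..v. 0) (inverse (down_factors q 1 0 v))" for v
    unfolding down_factors_def fps_inverse_prod by (intro degree_le_prod degree_le_inverse_down_factor) auto
  let ?e = "- (int j * (?M + 1)) + int (2 * (a - r)) * t n + int (T_exponent a r n) * 0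
    + (\<Sum>i=1..r * n. 0) + (\<Sum>i=1..r * n. int (n - j + i))
    + int (2 * a) * ((\<Sum>i=1..j. 0) + (\<Sum>i=1..n - j. - int (0 + i)))"
  have "degree_le ?e (pole_series q 1 a r n j)"
    unfolding pole_series_def fps_const_mult[symmetric] fps_const_power[symmetric] fps_inverse_mult
    by (intro degree_le_mult degree_le_power degree_le_q_powi qp X up down iup idown)
  moreover have "?e \<le> e"
  proof -
    have s1: "(\<Sum>i=1..r * n. int (n - j + i)) = int (r * n) * int (n - j) + t (r * n)"
      by (simp add: t_def sum.distrib)
    have s2: "(\<Sum>i=1..n - j. - int (0 + i)) = - t (n - j)" by (simp add: t_def sum_negf)
    have M: "?M + 1 = int (a - r) * int n + int a - 1"
      using assms by (simp add: T_exponent_def of_nat_diff)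
    \<comment> \<open>Additive parameters remove the truncated subtractions, after which the degree
      count is a polynomial identity.\<close>
    obtain l where n: "n = j + l" using assms(3) le_Suc_ex by blast
    obtain c where a: "a = r + c" using assms(2) less_imp_add_positive by blast
    have "?e = - (int j * (?M + 1)) + int (2 * (a - r)) * t n
        + (int (r * n) * int (n - j) + t (r * n)) - int (2 * a) * t (n - j)"
      unfolding s1 s2 by simp
    then have "2 * ?e = - (2 * (int j * (?M + 1))) + int (2 * (a - r)) * (2 * t n)
        + 2 * (int (r * n) * int (n - j)) + 2 * t (r * n) - int (2 * a) * (2 * t (n - j))"
      by (simp add: algebra_simps)
    also have "\<dots> = 2 * int a * int j * int (n - j) + 2 * int j + (int r * int n)\<^sup>2 - int r * int n"
      unfolding t M by (simp add: n a power2_eq_square algebra_simps)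
    also have "\<dots> \<le> 2 * e" using assms(4) by (simp flip: of_nat_mult)
    finally show ?thesis by simp
  qed
  ultimately show ?thesis by (rule q_powi_times_nth_mem)
qed

end

text \<open>The summands have degrees \<open>k (1 - s)\<close> and \<open>- k\<close> in
  \<open>q\<close>, so the weights do not worsen the degree bound.\<close>

lemma P0_weight_infinite_place:
  assumes "infinite_place S qq" "s \<ge> 1"
  shows "P0_weight n s j \<in> S"
proof -
  interpret infinite_place S qq by fact
  let ?x = "inverse qq"
  have e: "1 - qq ^ k = - (qq ^ k * (1 - ?x ^ k))" for k
    using q_nonzero by (simp add: right_diff_distrib power_inverse)
  have eq: "x / (1 - qq ^ k) ^ s = (-1) ^ s * (x * ?x ^ (k * s)) * inverse (1 - ?x ^ k) ^ s" for x k
  proof -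
    have "inverse (1 - qq ^ k) = (-1) * ?x ^ k * inverse (1 - ?x ^ k)"
      unfolding e by (simp add: power_inverse)
    then have "inverse (1 - qq ^ k) ^ s = (-1) ^ s * ?x ^ (k * s) * inverse (1 - ?x ^ k) ^ s"
      by (simp only: power_mult_distrib power_mult)
    then show ?thesis by (simp only: divide_inverse power_inverse[symmetric] mult_ac)
  qed
  obtain t where s: "s = Suc t" using assms(2) by (cases s) auto
  have c: "qq ^ k * ?x ^ (k + m) = ?x ^ m" for k m
    using q_nonzero by (simp add: power_add power_inverse)
  have 1: "qq ^ k * ?x ^ (k * s) = ?x ^ (k * t)" for k using c[of k "k * t"] by (simp add: s)
  have 2: "qq ^ (k * (s - 1)) * ?x ^ (k * s) = ?x ^ k" for k
    using c[of "k * t" k] by (simp add: s add.commute)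
  show ?thesis unfolding P0_weight_def eq 1 2
    by (intro diff_mem sum_mem mult_mem power_mem minus_one_power_mem inverse_q_mem unit) auto
qed

lemma P0_hat_infinite_place:
  assumes "infinite_place S qq" "0 < r" "r < a"
    and e: "\<And>j. j \<le> n \<Longrightarrow> 2 * int a * int j * int (n - j) + 2 * int j + (int r * int n)\<^sup>2 \<le> 2 * e"
  shows "qq powi (- e) * P0_hat (2 * a) r n \<in> S"
proof -
  interpret infinite_place S qq by fact
  have b: "qq powi (- e) * b_coeff a r n s j \<in> S" if "s \<in> {1..2 * a}" "j \<in> {0..n}" for s j
    using degree_le_pole_series[OF assms(2,3) _ e, of j "2 * a - s"] b_coeff_eq[OF assms(2,3), of j n s 1] that
    by simp
  have "qq powi (- e) * P0_hat (2 * a) r n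
      = (\<Sum>s=1..2 * a. \<Sum>j=0..n. (qq powi (- e) * b_coeff a r n s j) * P0_weight n s j)
        + (\<Sum>j=0..n. of_nat j * (qq powi (- e) * b_coeff a r n 1 j))"
    unfolding P0_hat_eq[OF assms(2,3)] distrib_left sum_distrib_left by (simp only: mult_ac)
  also have "\<dots> \<in> S"
    using assms(3) by (intro add_mem sum_mem mult_mem[OF b] mult_mem[OF of_nat_mem b] P0_weight_infinite_place assms) auto
  finally show ?thesis .
qed

subsection \<open>From local to global\<close>

abbreviation (input) at_inv_q :: "int poly \<Rightarrow> ratfun" where
  "at_inv_q f \<equiv> int_poly_at f (1 / qq)"

lemma at_inv_q_add: "at_inv_q (f + g) = at_inv_q f + at_inv_q g"
proof -
  have "map_poly of_int (f + g) = map_poly of_int f + (map_poly of_int g :: ratfun poly)"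
    by (rule poly_eqI) (simp add: coeff_map_poly)
  then show ?thesis by (simp add: int_poly_at_def)
qed

lemma at_inv_q_mult: "at_inv_q (f * g) = at_inv_q f * at_inv_q g"
proof -
  have "map_poly of_int (f * g) = map_poly of_int f * (map_poly of_int g :: ratfun poly)"
    by (rule poly_eqI) (simp add: coeff_map_poly coeff_mult)
  then show ?thesis by (simp add: int_poly_at_def)
qed

lemma at_inv_q_1: "at_inv_q 1 = 1"
  by (simp add: int_poly_at_def)

lemma at_inv_q_0: "at_inv_q 0 = 0"
  by (simp add: int_poly_at_def)

lemma at_inv_q_uminus: "at_inv_q (- f) = - at_inv_q f"
  using at_inv_q_add[of f "- f"] by (simp add: at_inv_q_0 eq_neg_iff_add_eq_0 add.commute)

lemma at_inv_q_diff: "at_inv_q (f - g) = at_inv_q f - at_inv_q g"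
  using at_inv_q_add[of f "- g"] by (simp add: at_inv_q_uminus)

lemma at_inv_q_of_nat: "at_inv_q (of_nat k) = of_nat k"
  by (induction k) (simp_all add: at_inv_q_0 at_inv_q_1 at_inv_q_add)

lemma at_inv_q_X_power: "at_inv_q ([:0, 1:] ^ k) = inverse qq ^ k"
proof (induction k)
  case (Suc k)
  have "at_inv_q [:0, 1:] = inverse qq"
    by (simp add: int_poly_at_def map_poly_pCons inverse_eq_divide)
  then show ?case using Suc by (simp only: power_Suc at_inv_q_mult)
qed (simp add: at_inv_q_1)

lemma at_inv_q_eq_0_iff: "at_inv_q f = 0 \<longleftrightarrow> f = 0"
proof
  assume "at_inv_q f = 0"
  moreover have "map_poly of_rat (map_poly rat_of_int f) = (map_poly of_int f :: ratfun poly)"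
    by (rule poly_eqI) (simp add: coeff_map_poly)
  ultimately have "rat_poly_at (map_poly rat_of_int f) (1 / qq) = 0"
    by (simp add: int_poly_at_def rat_poly_at_def)
  then have "map_poly rat_of_int f = 0" using rat_poly_at_inv_q_nonzero by blast
  then show "f = 0" by (simp add: poly_eq_iff coeff_map_poly)
qed (simp add: at_inv_q_0)

lemma at_inv_q_eq_iff: "at_inv_q f = at_inv_q g \<longleftrightarrow> f = g"
  using at_inv_q_eq_0_iff[of "f - g"] by (simp add: at_inv_q_diff)

text \<open>The local ring of Z[1/q] at \<open>p\<close>, where the variable of the integer
  polynomials stands for \<open>1/q\<close>.\<close>

definition localisation :: "int poly \<Rightarrow> ratfun set" where
  "localisation p = {at_inv_q f / at_inv_q g | f g. \<not> p dvd g}"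

lemma at_inv_q_mem_localisation:
  assumes "prime_elem p"
  shows "at_inv_q f \<in> localisation p"
proof -
  have "at_inv_q f = at_inv_q f / at_inv_q 1" "\<not> p dvd 1"
    using assms by (simp_all add: at_inv_q_1 prime_elem_def)
  then show ?thesis unfolding localisation_def by blast
qed

lemma inverse_mem_localisation:
  assumes "\<not> p dvd g"
  shows "inverse (at_inv_q g) \<in> localisation p"
proof -
  have "inverse (at_inv_q g) = at_inv_q 1 / at_inv_q g"
    by (simp add: at_inv_q_1 inverse_eq_divide)
  then show ?thesis using assms unfolding localisation_def by blast
qed

lemma subring_of_localisation:
  assumes "prime_elem p"
  shows "subring_of (localisation p)"
proof
  show "1 \<in> localisation p"
    using at_inv_q_mem_localisation[OF assms, of 1] by (simp add: at_inv_q_1)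
next
  fix x y assume "x \<in> localisation p" "y \<in> localisation p"
  then obtain f g f' g' where x: "x = at_inv_q f / at_inv_q g" "\<not> p dvd g"
    and y: "y = at_inv_q f' / at_inv_q g'" "\<not> p dvd g'"
    by (auto simp: localisation_def)
  then have nz: "at_inv_q g \<noteq> 0" "at_inv_q g' \<noteq> 0" by (auto simp: at_inv_q_eq_0_iff)
  have ndvd: "\<not> p dvd g * g'"
    using x y assms by (simp add: prime_elem_dvd_mult_iff)
  have "x - y = at_inv_q (f * g' - f' * g) / at_inv_q (g * g')"
    using nz by (simp add: x y at_inv_q_diff at_inv_q_mult diff_frac_eq)
  then show "x - y \<in> localisation p" using ndvd unfolding localisation_def by blast
  have "x * y = at_inv_q (f * f') / at_inv_q (g * g')"
    by (simp add: x y at_inv_q_mult)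
  then show "x * y \<in> localisation p" using ndvd unfolding localisation_def by blast
qed

text \<open>Integer polynomials form a factorial ring: a prime factor of the reduced denominator
  would contradict membership in its own localisation, so the denominator is a unit.\<close>

lemma Z_inv_qI_local:
  assumes "\<And>p. prime_elem p \<Longrightarrow> x \<in> localisation p"
  shows "x \<in> Z_inv_q"
proof -
  \<comment> \<open>Any single localisation provides a representation as a quotient of integer
    polynomials in \<open>1/q\<close>; this prime is at hand.\<close>
  have "prime_elem ([:0, 1:] :: int poly)"
    by (rule prime_elem_linear_poly) simp_all
  then obtain f g where x: "x = at_inv_q f / at_inv_q g" "\<not> [:0, 1:] dvd g"
    using assms by (fastforce simp: localisation_def)
  have g: "g \<noteq> 0" using x(2) by auto
  obtain f' g' where fg: "f = gcd f g * f'" "g = gcd f g * g'" "coprime f' g'"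
    using gcd_coprime_exists[of f g] g by (auto simp: mult.commute)
  have "gcd f g \<noteq> 0" "g' \<noteq> 0" using g fg(2) by auto
  then have x': "x = at_inv_q f' / at_inv_q g'"
    using x(1) fg(1,2) by (metis at_inv_q_mult at_inv_q_eq_0_iff mult_divide_mult_cancel_left)
  have "is_unit g'"
  proof (rule ccontr)
    assume "\<not> is_unit g'"
    then obtain p where p: "p dvd g'" "prime p"
      using prime_divisor_exists[OF \<open>g' \<noteq> 0\<close>] by blast
    then have "prime_elem p" by simp
    then obtain h k where hk: "x = at_inv_q h / at_inv_q k" "\<not> p dvd k"
      using assms by (fastforce simp: localisation_def)
    have "at_inv_q k \<noteq> 0" "at_inv_q g' \<noteq> 0"
      using hk(2) \<open>g' \<noteq> 0\<close> by (auto simp: at_inv_q_eq_0_iff)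
    then have "at_inv_q (f' * k) = at_inv_q (h * g')"
      using x' hk(1) by (simp add: at_inv_q_mult frac_eq_eq)
    then have "f' * k = h * g'" by (simp only: at_inv_q_eq_iff)
    then have "p dvd f' * k" using p(1) by simp
    then have "p dvd f'" using hk(2) \<open>prime_elem p\<close> by (simp add: prime_elem_dvd_mult_iff)
    then have "is_unit p" using fg(3) p(1) coprime_common_divisor by blast
    then show False using \<open>prime_elem p\<close> by (simp add: prime_elem_def)
  qed
  then obtain u where "g' * u = 1" by (metis dvdE)
  then have "at_inv_q g' * at_inv_q u = 1" by (metis at_inv_q_1 at_inv_q_mult)
  then have "x = at_inv_q (f' * u)"
    unfolding x' at_inv_q_mult using \<open>g' \<noteq> 0\<close> by (simp add: at_inv_q_eq_0_iff field_simps)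
  then show ?thesis by (auto simp: Z_inv_q_def)
qed

lemma d_poly_multiple:
  assumes "1 \<le> k" "k \<le> n"
  shows "1 - [:0, 1:] ^ k dvd d_poly n"
proof -
  have "is_common_mult n (d_poly n)"
    using theI'[OF d_poly_ex1[of n]] by (simp add: d_poly_def)
  then show ?thesis using assms by (simp add: is_common_mult_def monom_altdef)
qed

text \<open>A prime dividing the variable cannot also divide \<open>1 - X^k\<close>, so these
  elements become units.\<close>

lemma infinite_place_localisation:
  assumes "prime_elem p" "p dvd [:0, 1:]"
  shows "infinite_place (localisation p) qq"
proof -
  interpret subring_of "localisation p" by (rule subring_of_localisation) fact
  show ?thesis
  proof
    show "inverse qq \<in> localisation p"
      using at_inv_q_mem_localisation[OF assms(1), of "[:0, 1:] ^ 1"] unfolding at_inv_q_X_power by simp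
    show "inverse (1 - inverse qq ^ k) \<in> localisation p" if "k > 0" for k
    proof -
      have "p dvd [:0, 1:] ^ k" using assms(2) that by (metis dvd_trans dvd_power)
      then have "\<not> p dvd 1 - [:0, 1:] ^ k"
        using assms(1) by (metis diff_add_cancel dvd_add prime_elem_def)
      then show ?thesis
        using inverse_mem_localisation[of p "1 - [:0, 1:] ^ k"]
        unfolding at_inv_q_diff at_inv_q_1 at_inv_q_X_power by blast
    qed
  qed (simp_all add: qq_nonzero qq_power_neq_1)
qed

lemma one_minus_qq_power: "1 - qq ^ k = - (qq ^ k * at_inv_q (1 - [:0, 1:] ^ k))"
  using qq_nonzero unfolding at_inv_q_diff at_inv_q_1 at_inv_q_X_power
  by (simp add: right_diff_distrib power_inverse)

lemma P0_hat_localisation: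
  assumes p: "prime_elem p" "\<not> p dvd [:0, 1:]" and "0 < r" "r < a"
  shows "at_inv_q (d_poly n) ^ (2 * a - 1) * P0_hat (2 * a) r n \<in> localisation p"
proof -
  let ?S = "localisation p"
  interpret subring_of ?S by (rule subring_of_localisation) fact
  have x: "inverse qq \<in> ?S"
    using at_inv_q_mem_localisation[OF p(1), of "[:0, 1:] ^ 1"] unfolding at_inv_q_X_power by simp
  have q: "qq \<in> ?S"
    using inverse_mem_localisation[of p "[:0, 1:] ^ 1"] p(2) unfolding at_inv_q_X_power by simp
  have inv: "inverse (1 - qq ^ k) \<in> ?S" if "\<not> p dvd 1 - [:0, 1:] ^ k" for k
  proof -
    have eq: "inverse (1 - qq ^ k) = - (inverse qq ^ k * inverse (at_inv_q (1 - [:0, 1:] ^ k)))"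
      unfolding one_minus_qq_power by (simp add: power_inverse)
    show ?thesis
      unfolding eq by (intro uminus_mem mult_mem power_mem x inverse_mem_localisation that)
  qed
  have qk: "qq powi k \<in> ?S" for k
    unfolding power_int_def using q x by (auto intro: power_mem)
  show ?thesis
  proof (cases "\<exists>k. 1 \<le> k \<and> k \<le> n \<and> p dvd 1 - [:0, 1:] ^ k")
    case False
    have "local_data ?S 1 qq 1 n"
      by unfold_locales
         (use False in \<open>auto simp: qq_nonzero q x qq_powi_neq_1 divide_inverse intro!: one_mem diff_mem qk inv\<close>)
    then have "1 ^ (2 * a) * P0_hat (2 * a) r n \<in> ?S"
      using assms(3,4) by (rule P0_hat_local_data)
    then show ?thesis
      by (intro mult_mem power_mem at_inv_q_mem_localisation p) simp
  next
    case True
    \<comment> \<open>This is the multiplicative order of \<open>1/q\<close> modulo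
      \<open>p\<close>: by minimality \<open>p\<close> divides \<open>1 - X^k\<close> exactly for
      the multiples \<open>k\<close> of \<open>d\<close>.\<close>
    define d where "d = (LEAST k. 1 \<le> k \<and> k \<le> n \<and> p dvd 1 - [:0, 1:] ^ k)"
    have d: "1 \<le> d" "d \<le> n" "p dvd 1 - [:0, 1:] ^ d"
      using LeastI_ex[OF True] by (auto simp: d_def)
    have least: "\<not> p dvd 1 - [:0, 1:] ^ k" if "1 \<le> k" "k < d" for k
      using not_less_Least[of k "\<lambda>k. 1 \<le> k \<and> k \<le> n \<and> p dvd 1 - [:0, 1:] ^ k"] that d(2)
      by (auto simp: d_def)
    have pd: "p dvd 1 - ([:0, 1:] ^ d) ^ m" for m
      using d(3) by (metis dvd_trans dvd_triv_left one_diff_power_eq)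
    have nonmult: "\<not> p dvd 1 - [:0, 1:] ^ k" if "\<not> d dvd k" for k
    proof
      assume "p dvd 1 - [:0, 1:] ^ k"
      moreover have "[:0, 1:] ^ k = ([:0, 1:] ^ d) ^ (k div d) * [:0, 1 :: int:] ^ (k mod d)"
        by (simp flip: power_mult power_add)
      then have "1 - [:0, 1:] ^ (k mod d) = (1 - [:0, 1:] ^ k)
          - (1 - ([:0, 1:] ^ d) ^ (k div d)) * [:0, 1 :: int:] ^ (k mod d)"
        by (simp add: left_diff_distrib)
      ultimately have "p dvd 1 - [:0, 1:] ^ (k mod d)"
        using pd by (metis dvd_diff dvd_mult2)
      moreover have "k mod d < d" "1 \<le> k mod d"
        using d(1) that by (auto simp: dvd_eq_mod_eq_0)
      ultimately show False using least by blast
    qed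
    \<comment> \<open>Otherwise \<open>p\<close> would be a constant dividing the constant
      coefficient 1 of \<open>1 - X^d\<close>. This makes the harmonic sums integral and allows the
      division by 2.\<close>
    have nat_ndvd: "\<not> p dvd of_nat m" if "m > 0" for m
    proof
      assume "p dvd of_nat m"
      then have "degree p \<le> degree (of_nat m :: int poly)"
        using that by (intro dvd_imp_degree_le) auto
      then obtain c where c: "p = [:c:]" by (auto simp: of_nat_poly elim: degree_eq_zeroE)
      then have "c dvd coeff (1 - [:0, 1:] ^ d) 0" using d(3) const_poly_dvd_iff by blast
      also have "coeff (1 - [:0, 1:] ^ d :: int poly) 0 = 1"
        using d(1) by (simp add: coeff_0_power)
      finally have "is_unit p" by (simp add: c is_unit_const_poly_iff)
      then show False using p(1) by (simp add: prime_elem_def)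
    qed
    let ?\<pi> = "1 - qq ^ d"
    have \<pi>: "?\<pi> \<noteq> 0" using qq_power_neq_1[of d] d(1) by simp
    have geo: "1 - qq ^ (d * m) = ?\<pi> * (\<Sum>i<m. (qq ^ d) ^ i)" for m
      unfolding power_mult by (rule one_diff_power_eq)
    have mult_mem_nat: "(1 - qq ^ (d * m)) / ?\<pi> \<in> ?S" for m
      unfolding geo using \<pi> by (simp, intro sum_mem power_mem q)
    have "local_root ?S ?\<pi> qq d n"
    proof unfold_locales
      show "?\<pi> \<in> ?S" by (intro diff_mem one_mem power_mem q)
      show "(1 - qq powi k) / ?\<pi> \<in> ?S" if dvd: "int d dvd k" for k
      proof (cases "k \<ge> 0")
        case True
        then obtain l where "k = int l" by (rule nonneg_int_cases)
        moreover from this obtain m where "l = d * m" using dvd by (metis dvdE int_dvd_int_iff)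
        ultimately have "k = int (d * m)" by simp
        then show ?thesis using mult_mem_nat[of m] by (simp flip: of_nat_mult)
      next
        case False
        then obtain l where "- k = int l" using nonneg_int_cases[of "- k"] by auto
        moreover from this obtain m where "l = d * m" using dvd
          by (metis dvdE dvd_minus_iff int_dvd_int_iff)
        ultimately have k: "k = - int (d * m)" by simp
        have "(1 - qq powi k) / ?\<pi> = - (qq powi k * ((1 - qq ^ (d * m)) / ?\<pi>))"
          unfolding k power_int_minus power_int_of_nat using qq_nonzero
          by (simp add: right_diff_distrib diff_divide_distrib)
        then show ?thesis using mult_mem_nat[of m] by (simp only: uminus_mem mult_mem qk)
      qed
      show "inverse (1 - qq ^ k) \<in> ?S" if "\<not> d dvd k" for k
        using that by (intro inv nonmult)
      show "?\<pi> / (1 - qq ^ k) \<in> ?S" if "1 \<le> k" "k \<le> n" "d dvd k" for k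
      proof -
        obtain m where m: "k = d * m" using \<open>d dvd k\<close> by (elim dvdE)
        have "m > 0" using m that(1) by (cases m) auto
        \<comment> \<open>The cofactor of \<open>1 - X^d\<close> in \<open>1 - X^k\<close> is
          congruent to \<open>m\<close> modulo \<open>p\<close>, hence a unit of the
          localisation.\<close>
        let ?g = "\<Sum>i<m. ([:0, 1 :: int:] ^ d) ^ i"
        have "p dvd of_nat m - ?g"
        proof -
          have "of_nat m - ?g = (\<Sum>i<m. 1 - ([:0, 1:] ^ d) ^ i)" by (simp add: sum_subtractf)
          then show ?thesis using pd by (simp add: dvd_sum)
        qed
        then have "\<not> p dvd ?g" using nat_ndvd[OF \<open>m > 0\<close>] by (metis diff_add_cancel dvd_add)
        then have g: "inverse (at_inv_q ?g) \<in> ?S" by (rule inverse_mem_localisation)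
        have "1 - [:0, 1:] ^ k = (1 - [:0, 1:] ^ d) * ?g"
          unfolding m power_mult by (rule one_diff_power_eq)
        then have "1 - qq ^ k = - (qq ^ k * (at_inv_q (1 - [:0, 1:] ^ d) * at_inv_q ?g))"
          by (simp only: one_minus_qq_power[of k] at_inv_q_mult)
        moreover have "?\<pi> = - (qq ^ d * at_inv_q (1 - [:0, 1:] ^ d))" by (rule one_minus_qq_power)
        ultimately have "?\<pi> / (1 - qq ^ k) = qq ^ d * inverse qq ^ k * inverse (at_inv_q ?g)"
          using \<pi> qq_nonzero by (simp add: divide_inverse power_inverse)
        then show ?thesis using g by (simp only: mult_mem power_mem q x)
      qed
      show "inverse (of_nat m) \<in> ?S" if "m > 0" for m
        using inverse_mem_localisation[OF nat_ndvd[OF that]] by (simp add: at_inv_q_of_nat)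
    qed (use d \<pi> in \<open>simp_all add: qq_nonzero q x qq_powi_neq_1\<close>)
    then have loc: "?\<pi> ^ (2 * a - 1) * P0_hat (2 * a) r n \<in> ?S"
      using assms(3,4) by (rule P0_hat_local_root)
    \<comment> \<open>One factor \<open>1 - X^d\<close> per copy of \<open>d_poly n\<close> clears
      the pole at this prime; up to a power of \<open>q\<close> it is the modulus.\<close>
    obtain h where "d_poly n = (1 - [:0, 1:] ^ d) * h" using d_poly_multiple[OF d(1,2)] by (elim dvdE)
    then have "at_inv_q (d_poly n) = ?\<pi> * (- (inverse qq ^ d) * at_inv_q h)"
      unfolding one_minus_qq_power[of d] using qq_nonzero by (simp add: at_inv_q_mult power_inverse)
    then have "at_inv_q (d_poly n) ^ (2 * a - 1) * P0_hat (2 * a) r n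
        = (- (inverse qq ^ d) * at_inv_q h) ^ (2 * a - 1) * (?\<pi> ^ (2 * a - 1) * P0_hat (2 * a) r n)"
      by (simp only: power_mult_distrib mult_ac)
    then show ?thesis
      using loc by (simp only: mult_mem power_mem uminus_mem x at_inv_q_mem_localisation[OF p(1)])
  qed
qed

theorem theorem4p1:
  fixes A r :: nat and \<alpha> :: real
  assumes "even A" and "r > 0" and "int A - 2 * int r > 0"
    and "\<alpha> = - real A / 8 - (real r)\<^sup>2 / 2"
  shows "\<exists>\<beta> \<gamma> :: real. \<forall>n :: nat.
    qq powi \<lfloor>\<alpha> * (real n)\<^sup>2 + \<beta> * real n + \<gamma>\<rfloor>
      * int_poly_at (d_poly n) (1 / qq) ^ (A - 1) * P0_hat A r n \<in> Z_inv_q"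
proof -
  obtain a where A: "A = 2 * a" using assms(1) by (elim evenE)
  have r: "0 < r" "r < a" using assms(2,3) A by auto
  \<comment> \<open>The choice \<open>\<beta> = -1\<close> pays for the term \<open>2 * j\<close> of
    the degree bound; rounding down goes in the favourable direction, so \<open>\<gamma> = 0\<close>
    works.\<close>
  have "qq powi \<lfloor>\<alpha> * (real n)\<^sup>2 + (-1) * real n + 0\<rfloor>
      * at_inv_q (d_poly n) ^ (A - 1) * P0_hat A r n \<in> Z_inv_q" (is "qq powi ?E * _ * _ \<in> _") for n
  proof (rule Z_inv_qI_local)
    fix p :: "int poly" assume p: "prime_elem p"
    interpret subring_of "localisation p" by (rule subring_of_localisation) fact
    show "qq powi ?E * at_inv_q (d_poly n) ^ (A - 1) * P0_hat A r n \<in> localisation p"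
    proof (cases "p dvd [:0, 1:]")
      case True
      have "2 * int a * int j * int (n - j) + 2 * int j + (int r * int n)\<^sup>2 \<le> 2 * (- ?E)" if "j \<le> n" for j
      proof -
        \<comment> \<open>The worst pole lies near \<open>j = n / 2\<close>. With
          \<open>a = A / 2\<close> this inequality bounds \<open>a j (n - j)\<close> by
          \<open>A n^2 / 8\<close>.\<close>
        have "4 * (real j * real (n - j)) \<le> (real n)\<^sup>2"
          using that zero_le_power2[of "real n - 2 * real j"]
          by (simp add: of_nat_diff power2_eq_square algebra_simps)
        then have "real a * (4 * (real j * real (n - j))) \<le> real a * (real n)\<^sup>2"
          by (rule mult_left_mono) simp
        moreover have "2 * \<alpha> * (real n)\<^sup>2 = - (real a * (real n)\<^sup>2 / 2) - (real r * real n)\<^sup>2"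
          by (simp add: assms(4) A power2_eq_square field_simps)
        moreover have "real_of_int ?E \<le> \<alpha> * (real n)\<^sup>2 + (-1) * real n + 0" by (rule of_int_floor_le)
        ultimately have "2 * real a * real j * real (n - j) + 2 * real j + (real r * real n)\<^sup>2
            \<le> 2 * (- real_of_int ?E)"
        proof -
          have "real a * (4 * (real j * real (n - j))) = 2 * (2 * real a * real j * real (n - j))"
            by simp
          moreover have "real j \<le> real n" using that by simp
          ultimately show ?thesis
            using \<open>real a * (4 * (real j * real (n - j))) \<le> real a * (real n)\<^sup>2\<close>
              \<open>2 * \<alpha> * (real n)\<^sup>2 = - (real a * (real n)\<^sup>2 / 2) - (real r * real n)\<^sup>2\<close>
              \<open>real_of_int ?E \<le> \<alpha> * (real n)\<^sup>2 + (-1) * real n + 0\<close> by linarith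
        qed
        then have "real_of_int (2 * int a * int j * int (n - j) + 2 * int j + (int r * int n)\<^sup>2)
            \<le> real_of_int (2 * (- ?E))" by simp
        then show ?thesis by (simp only: of_int_le_iff)
      qed
      from P0_hat_infinite_place[OF infinite_place_localisation[OF p True] r this]
      have "qq powi ?E * P0_hat A r n \<in> localisation p" by (simp add: A)
      moreover have "at_inv_q (d_poly n) ^ (A - 1) \<in> localisation p"
        by (intro power_mem at_inv_q_mem_localisation p)
      ultimately show ?thesis
        using mult_mem[of "at_inv_q (d_poly n) ^ (A - 1)" "qq powi ?E * P0_hat A r n"] by (simp only: mult_ac)
    next
      case False
      have "qq powi k \<in> localisation p" for k
        using at_inv_q_mem_localisation[OF p, of "[:0, 1:] ^ 1"]
          inverse_mem_localisation[of p "[:0, 1:] ^ 1"] False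
        unfolding at_inv_q_X_power power_int_def by (auto intro: power_mem)
      then show ?thesis
        using P0_hat_localisation[OF p False r, of n] unfolding A mult.assoc by (rule mult_mem)
    qed
  qed
  then show ?thesis by blast
qed

end
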